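(* Let $H\in\mathbb{R}$ and let $\{X(t),t>0\}$ be a zero-mean Gaussian locally self-similar process with covariance $R_X(t,s)=E(X(t)X^*(s))=Q(\sqrt{ts})\,C_X(t/s)$, $t,s>0$. Let $A_X$ be its scale invariant ambiguity function, $A_{E,X}=E\{A_X\}$, $U=\{(\theta,\tau)\in\mathbb{R}\times\mathbb{R}^+: E|A_X(\theta,\tau)|^2>0\}$, and let $\phi_{opt}(\theta,\tau)=\frac{|A_{E,X}(\theta,\tau)|^2}{E|A_X(\theta,\tau)|^2}I_U(\theta,\tau)$ be the (global) optimal ambiguity-domain kernel. (1) If $X$ is circularly symmetric, then for all $(\theta,\tau)\in U$ $$\phi_{opt}(\theta,\tau)=\frac{|C_X(\tau)|^2\,|(\mathcal{M}Q)(i2\pi\theta)|^2}{|C_X(\tau)|^2\,|(\mathcal{M}Q)(i2\pi\theta)|^2+(\mathcal{M}|C_X|^2)(i2\pi\theta)\,(Q\circledast Q^* )(\tau)},$$ where $(Q\circledast Q^* )(\tau):=\int_0^\infty Q(u\sqrt{\tau})\,Q^*(u/\sqrt{\tau})\,\frac{du}{u}$. (2) If $X$ is real-valued, then for all $(\theta,\tau)\in U$ the kernel $\phi_{opt}(\theta,\tau)$ is given by the same formula with the additional term $D_2(\theta,\tau)$ added to the denominator, where $$D_2(\theta,\tau)=A_{C_X}(\theta,\tau^2)\int_0^\infty Q^2(u)\,\frac{du}{u},\qquad A_{C_X}(\theta,\tau^2):=\int_0^\infty C_X(v\tau)\,C_X(v/\tau)\,v^{-i2\pi\theta-1}\,dv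 .$$
   Context: $^*$ denotes complex conjugation, $\mathbb{R}^+=(0,\infty)$, and $I_U$ is the indicator function of $U$. Mellin transform: $(\mathcal{M}g)(s)=\int_0^\infty g(t)\,t^{-s-1}\,dt$. Locally self-similar process (LSSP): a process $\{X(t),t>0\}$ with covariance $R_X(t,s)=(ts)^H q(\ln\sqrt{ts})\,C_X(t/s)=Q(\sqrt{ts})\,C_X(t/s)$, where $Q(t):=t^{2H}q(\ln t)$, $Q$ and $C_X$ are continuous and not identically zero, $C_X$ is nonnegative definite on the multiplicative group $\mathbb{R}^+$, and the normalization $C_X(1)=1$ is used, so that $Q\ge 0$. Circularly symmetric: the processes $\{e^{i\alpha}X(t)\}$ are identically distributed for all $\alpha\in[0,2\pi)$; consequently $E(X(t))=0$ and $E(X(t)X(s))=0$ for all $t,s$. Scale invariant ambiguity function: $A_X(\theta,\tau)=\int_0^\infty X(t\sqrt{\tau})\,X^*(t/\sqrt{\tau})\,t^{-i2\pi\theta-1}\,dt$ for $(\theta,\tau)\in\mathbb{R}\times\mathbb{R}^+$, a mean-square stochastic integral. Standing assumptions: the mean-square integrals defining $A_X(\theta,\tau)$ exist, expectation and integration may be interchanged in computing $E\{A_X\}$ and $E|A_X|^2$, and the deterministic integrals that appear converge absolutely. *)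

theory Defs
  imports "HOL-Probability.Probability"
begin

subsection \<open>Mellin transform and multiplicative convolution on the positive half-line\<close>

definition mellin_abs_conv :: "(real \<Rightarrow> complex) \<Rightarrow> complex \<Rightarrow> bool" where
  "mellin_abs_conv g s \<longleftrightarrow>
     set_integrable lborel {0<..} (\<lambda>t. g t * complex_of_real t powr (- s - 1))"

definition mellin :: "(real \<Rightarrow> complex) \<Rightarrow> complex \<Rightarrow> complex" where
  "mellin g s = (LINT t:{0<..}|lborel. g t * complex_of_real t powr (- s - 1))"

definition scale_conv_abs_conv :: "(real \<Rightarrow> complex) \<Rightarrow> (real \<Rightarrow> complex) \<Rightarrow> real \<Rightarrow> bool" where
  "scale_conv_abs_conv f g \<tau> \<longleftrightarrow>
     set_integrable lborel {0<..} (\<lambda>u. f (u * sqrt \<tau>) * g (u / sqrt \<tau>) / complex_of_real u)"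

definition scale_conv :: "(real \<Rightarrow> complex) \<Rightarrow> (real \<Rightarrow> complex) \<Rightarrow> real \<Rightarrow> complex" where
  "scale_conv f g \<tau> =
     (LINT u:{0<..}|lborel. f (u * sqrt \<tau>) * g (u / sqrt \<tau>) / complex_of_real u)"

subsection \<open>Gaussian and circularly symmetric processes indexed by the positive half-line\<close>

text \<open>Point masses count as Gaussian (variance zero).\<close>

definition gaussian_rv :: "'a measure \<Rightarrow> ('a \<Rightarrow> real) \<Rightarrow> bool" where
  "gaussian_rv M Y \<longleftrightarrow> Y \<in> borel_measurable M \<and>
     ((\<exists>\<mu> \<sigma>. 0 < \<sigma> \<and> distributed M lborel Y (\<lambda>x. ennreal (normal_density \<mu> \<sigma> x)))
      \<or> (\<exists>\<mu>. AE \<omega> in M. Y \<omega> = \<mu>))"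

text \<open>Joint Gaussianity of the real and imaginary parts of all finite families: since
  \<open>Re (c * z) = Re c * Re z - Im c * Im z\<close>, the real parts of complex linear combinations are
  exactly the real linear combinations of real and imaginary parts.\<close>

definition gaussian_process :: "'a measure \<Rightarrow> (real \<Rightarrow> 'a \<Rightarrow> complex) \<Rightarrow> bool" where
  "gaussian_process M X \<longleftrightarrow>
     (\<forall>F c. finite F \<and> F \<subseteq> {0<..} \<longrightarrow> gaussian_rv M (\<lambda>\<omega>. Re (\<Sum>t\<in>F. c t * X t \<omega>)))"

definition process_law :: "'a measure \<Rightarrow> (real \<Rightarrow> 'a \<Rightarrow> complex) \<Rightarrow> (real \<Rightarrow> complex) measure" where
  "process_law M X = distr M (Pi\<^sub>M {0<..} (\<lambda>_. borel)) (\<lambda>\<omega>. \<lambda>t\<in>{0<..}. X t \<omega>)"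

definition circularly_symmetric :: "'a measure \<Rightarrow> (real \<Rightarrow> 'a \<Rightarrow> complex) \<Rightarrow> bool" where
  "circularly_symmetric M X \<longleftrightarrow>
     (\<forall>\<alpha>\<in>{0..<2 * pi}. \<forall>\<beta>\<in>{0..<2 * pi}.
        process_law M (\<lambda>t \<omega>. cis \<alpha> * X t \<omega>) = process_law M (\<lambda>t \<omega>. cis \<beta> * X t \<omega>))"

definition real_valued_process :: "'a measure \<Rightarrow> (real \<Rightarrow> 'a \<Rightarrow> complex) \<Rightarrow> bool" where
  "real_valued_process M X \<longleftrightarrow> (\<forall>t>0. \<forall>\<omega>\<in>space M. X t \<omega> \<in> \<real>)"

definition zero_mean :: "'a measure \<Rightarrow> (real \<Rightarrow> 'a \<Rightarrow> complex) \<Rightarrow> bool" where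
  "zero_mean M X \<longleftrightarrow> (\<forall>t>0. integrable M (X t) \<and> (\<integral>\<omega>. X t \<omega> \<partial>M) = 0)"

subsection \<open>Locally self-similar covariances\<close>

definition mult_nonneg_definite :: "(real \<Rightarrow> complex) \<Rightarrow> bool" where
  "mult_nonneg_definite C \<longleftrightarrow>
     (\<forall>F c. finite F \<and> F \<subseteq> {0<..} \<longrightarrow>
        (\<Sum>t\<in>F. \<Sum>s\<in>F. c t * cnj (c s) * C (t / s)) \<in> \<real>\<^sub>\<ge>\<^sub>0)"

definition lssp_Q :: "real \<Rightarrow> (real \<Rightarrow> complex) \<Rightarrow> real \<Rightarrow> complex" where
  "lssp_Q H q t = complex_of_real (t powr (2 * H)) * q (ln t)"

text \<open>Covariance for a zero-mean process; nonnegativity of \<open>lssp_Q H q\<close> on the positive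
  half-line follows from \<open>C 1 = 1\<close> by taking \<open>t = s\<close>.\<close>

definition lssp ::
  "'a measure \<Rightarrow> (real \<Rightarrow> 'a \<Rightarrow> complex) \<Rightarrow> real \<Rightarrow> (real \<Rightarrow> complex) \<Rightarrow> (real \<Rightarrow> complex) \<Rightarrow> bool"
where
  "lssp M X H q C \<longleftrightarrow>
     continuous_on {0<..} (lssp_Q H q) \<and> (\<exists>t>0. lssp_Q H q t \<noteq> 0) \<and>
     continuous_on {0<..} C \<and> (\<exists>t>0. C t \<noteq> 0) \<and>
     mult_nonneg_definite C \<and> C 1 = 1 \<and>
     (\<forall>t>0. \<forall>s>0. integrable M (\<lambda>\<omega>. X t \<omega> * cnj (X s \<omega>)) \<and>
        (\<integral>\<omega>. X t \<omega> * cnj (X s \<omega>) \<partial>M) = lssp_Q H q (sqrt (t * s)) * C (t / s))"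

subsection \<open>Mean-square stochastic integrals\<close>

definition square_integrable_rv :: "'a measure \<Rightarrow> ('a \<Rightarrow> complex) \<Rightarrow> bool" where
  "square_integrable_rv M Z \<longleftrightarrow>
     Z \<in> borel_measurable M \<and> integrable M (\<lambda>\<omega>. (cmod (Z \<omega>))\<^sup>2)"

text \<open>Mean-square limit of Riemann sums over tagged divisions of \<open>[a, b]\<close> as the mesh tends
  to zero.\<close>

definition has_ms_integral_on ::
  "'a measure \<Rightarrow> (real \<Rightarrow> 'a \<Rightarrow> complex) \<Rightarrow> real \<Rightarrow> real \<Rightarrow> ('a \<Rightarrow> complex) \<Rightarrow> bool" where
  "has_ms_integral_on M Y a b Z \<longleftrightarrow>
     square_integrable_rv M Z \<and> (\<forall>t\<in>{a..b}. square_integrable_rv M (Y t)) \<and>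
     (\<forall>\<epsilon>>0. \<exists>\<delta>>0. \<forall>D. D tagged_division_of {a..b} \<and> (\<lambda>x. ball x \<delta>) fine D \<longrightarrow>
        (\<integral>\<omega>. (cmod ((\<Sum>(x, K)\<in>D. measure lborel K *\<^sub>R Y x \<omega>) - Z \<omega>))\<^sup>2 \<partial>M) < \<epsilon>)"

text \<open>Improper integral over \<open>(0, \<infinity>)\<close>: mean-square limit as \<open>a\<close> tends to \<open>0\<close> and \<open>b\<close> to
  \<open>\<infinity>\<close> independently.\<close>

definition has_ms_integral :: "'a measure \<Rightarrow> (real \<Rightarrow> 'a \<Rightarrow> complex) \<Rightarrow> ('a \<Rightarrow> complex) \<Rightarrow> bool"
where
  "has_ms_integral M Y Z \<longleftrightarrow>
     square_integrable_rv M Z \<and>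
     (\<exists>J. (\<forall>a b. 0 < a \<and> a < b \<longrightarrow> has_ms_integral_on M Y a b (J a b)) \<and>
          ((\<lambda>(a, b). \<integral>\<omega>. (cmod (J a b \<omega> - Z \<omega>))\<^sup>2 \<partial>M) \<longlongrightarrow> 0) (at_right 0 \<times>\<^sub>F at_top))"

subsection \<open>Scale invariant ambiguity function and optimal kernel\<close>

definition ambiguity_integrand ::
  "(real \<Rightarrow> 'a \<Rightarrow> complex) \<Rightarrow> real \<Rightarrow> real \<Rightarrow> real \<Rightarrow> 'a \<Rightarrow> complex" where
  "ambiguity_integrand X \<theta> \<tau> t \<omega> =
     X (t * sqrt \<tau>) \<omega> * cnj (X (t / sqrt \<tau>) \<omega>) *
     complex_of_real t powr (- (\<i> * complex_of_real (2 * pi * \<theta>)) - 1)"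

text \<open>A mean-square integral is determined only almost surely, so \<open>A\<close> is any version of the
  scale invariant ambiguity function.\<close>

definition is_ambiguity_function ::
  "'a measure \<Rightarrow> (real \<Rightarrow> 'a \<Rightarrow> complex) \<Rightarrow> (real \<Rightarrow> real \<Rightarrow> 'a \<Rightarrow> complex) \<Rightarrow> bool" where
  "is_ambiguity_function M X A \<longleftrightarrow>
     (\<forall>\<theta>. \<forall>\<tau>>0. has_ms_integral M (ambiguity_integrand X \<theta> \<tau>) (A \<theta> \<tau>))"

definition expected_ambiguity ::
  "'a measure \<Rightarrow> (real \<Rightarrow> real \<Rightarrow> 'a \<Rightarrow> complex) \<Rightarrow> real \<Rightarrow> real \<Rightarrow> complex" where
  "expected_ambiguity M A \<theta> \<tau> = (\<integral>\<omega>. A \<theta> \<tau> \<omega> \<partial>M)"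

definition ambiguity_power ::
  "'a measure \<Rightarrow> (real \<Rightarrow> real \<Rightarrow> 'a \<Rightarrow> complex) \<Rightarrow> real \<Rightarrow> real \<Rightarrow> real" where
  "ambiguity_power M A \<theta> \<tau> = (\<integral>\<omega>. (cmod (A \<theta> \<tau> \<omega>))\<^sup>2 \<partial>M)"

text \<open>Expectation and integration may be interchanged in the mean of \<open>A\<close> and, writing
  \<open>|A|\<^sup>2\<close> as a double integral of \<open>Y t * cnj (Y s)\<close> with \<open>Y\<close> the integrand, in its
  mean square; the resulting deterministic integrals converge absolutely.\<close>

definition ambiguity_interchange ::
  "'a measure \<Rightarrow> (real \<Rightarrow> 'a \<Rightarrow> complex) \<Rightarrow> (real \<Rightarrow> real \<Rightarrow> 'a \<Rightarrow> complex) \<Rightarrow> bool" where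
  "ambiguity_interchange M X A \<longleftrightarrow> (\<forall>\<theta>. \<forall>\<tau>>0.
     set_integrable lborel {0<..} (\<lambda>t. \<integral>\<omega>. ambiguity_integrand X \<theta> \<tau> t \<omega> \<partial>M) \<and>
     expected_ambiguity M A \<theta> \<tau> =
       (LINT t:{0<..}|lborel. (\<integral>\<omega>. ambiguity_integrand X \<theta> \<tau> t \<omega> \<partial>M)) \<and>
     set_integrable lborel ({0<..} \<times> {0<..}) (\<lambda>(t, s).
       \<integral>\<omega>. ambiguity_integrand X \<theta> \<tau> t \<omega> * cnj (ambiguity_integrand X \<theta> \<tau> s \<omega>) \<partial>M) \<and>
     complex_of_real (ambiguity_power M A \<theta> \<tau>) =
       (LINT p:{0<..} \<times> {0<..}|lborel. (case p of (t, s) \<Rightarrow>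
         \<integral>\<omega>. ambiguity_integrand X \<theta> \<tau> t \<omega> * cnj (ambiguity_integrand X \<theta> \<tau> s \<omega>) \<partial>M)))"

definition ambiguity_support ::
  "'a measure \<Rightarrow> (real \<Rightarrow> real \<Rightarrow> 'a \<Rightarrow> complex) \<Rightarrow> (real \<times> real) set" where
  "ambiguity_support M A = {(\<theta>, \<tau>). 0 < \<tau> \<and> 0 < ambiguity_power M A \<theta> \<tau>}"

definition phi_opt ::
  "'a measure \<Rightarrow> (real \<Rightarrow> real \<Rightarrow> 'a \<Rightarrow> complex) \<Rightarrow> real \<Rightarrow> real \<Rightarrow> real" where
  "phi_opt M A \<theta> \<tau> =
     (cmod (expected_ambiguity M A \<theta> \<tau>))\<^sup>2 / ambiguity_power M A \<theta> \<tau>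
     * indicator (ambiguity_support M A) (\<theta>, \<tau>)"

subsection \<open>Integrals in the kernel formulas\<close>

text \<open>The integral written \<open>A\<^sub>C(\<theta>, \<tau>\<^sup>2)\<close>, as a function of \<open>\<theta>\<close> and \<open>\<tau>\<close> (not \<open>\<tau>\<^sup>2\<close>).\<close>

definition C_ambiguity_sq_integrand ::
  "(real \<Rightarrow> complex) \<Rightarrow> real \<Rightarrow> real \<Rightarrow> real \<Rightarrow> complex" where
  "C_ambiguity_sq_integrand C \<theta> \<tau> v = C (v * \<tau>) * C (v / \<tau>) *
     complex_of_real v powr (- (\<i> * complex_of_real (2 * pi * \<theta>)) - 1)"

definition C_ambiguity_sq :: "(real \<Rightarrow> complex) \<Rightarrow> real \<Rightarrow> real \<Rightarrow> complex" where
  "C_ambiguity_sq C \<theta> \<tau> = (LINT v:{0<..}|lborel. C_ambiguity_sq_integrand C \<theta> \<tau> v)"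

definition kernel_D2 :: "(real \<Rightarrow> complex) \<Rightarrow> (real \<Rightarrow> complex) \<Rightarrow> real \<Rightarrow> real \<Rightarrow> complex" where
  "kernel_D2 Q C \<theta> \<tau> =
     C_ambiguity_sq C \<theta> \<tau> * (LINT u:{0<..}|lborel. (Q u)\<^sup>2 / complex_of_real u)"

definition kernel_abs_conv :: "(real \<Rightarrow> complex) \<Rightarrow> (real \<Rightarrow> complex) \<Rightarrow> bool" where
  "kernel_abs_conv Q C \<longleftrightarrow> (\<forall>\<theta>. \<forall>\<tau>>0.
     mellin_abs_conv Q (\<i> * complex_of_real (2 * pi * \<theta>)) \<and>
     mellin_abs_conv (\<lambda>v. complex_of_real ((cmod (C v))\<^sup>2)) (\<i> * complex_of_real (2 * pi * \<theta>)) \<and>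
     scale_conv_abs_conv Q (\<lambda>u. cnj (Q u)) \<tau>)"

definition kernel_D2_abs_conv :: "(real \<Rightarrow> complex) \<Rightarrow> (real \<Rightarrow> complex) \<Rightarrow> bool" where
  "kernel_D2_abs_conv Q C \<longleftrightarrow>
     (\<forall>\<theta>. \<forall>\<tau>>0. set_integrable lborel {0<..} (C_ambiguity_sq_integrand C \<theta> \<tau>)) \<and>
     set_integrable lborel {0<..} (\<lambda>u. (Q u)\<^sup>2 / complex_of_real u)"

end

theory Submission
  imports Defs
begin

text \<open>Isserlis' theorem splits the covariance of the ambiguity integrand at \<open>t, s\<close> into three
  products of second moments. The first separates in \<open>(t, s)\<close> and gives the squared modulus of
  the mean. The other two separate in the coordinates \<open>u = sqrt (t * s)\<close>, \<open>v = t / s\<close>, which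
  preserve the Haar measure \<open>dt/t ds/s = du/u dv/v\<close>. The third one involves only
  pseudo-covariances: it vanishes under circular symmetry and is the \<open>D2\<close> term for real-valued
  processes.\<close>

subsection \<open>Geometric mean and ratio as coordinates on the quadrant\<close>

text \<open>Gaussianity is given only through one-dimensional laws of real linear combinations, so
  Isserlis' theorem is derived without a joint density. The relation
  \<open>E f^4 = 3 (E f^2)^2\<close> for every \<open>f\<close> in a real linear space already
  implies it: both sides are polynomial in the coefficients of \<open>f\<close>, so complex
  coefficients are allowed as well and polarisation recovers the mixed moments. The geometric means
  and ratios of the paired times explain the shape of the kernel. Pairing times with equal shifts
  gives the means \<open>u * sqrt \<tau>\<close> and \<open>u / sqrt \<tau>\<close> and twice the
  ratio \<open>v\<close>, hence \<open>Q\<close> times its conjugate in \<open>u\<close> and the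
  squared modulus of \<open>C\<close> in \<open>v\<close>. Pairing opposite shifts gives twice the
  mean \<open>u\<close> and the ratios \<open>v * \<tau>\<close> and \<open>v / \<tau>\<close>,
  hence the square of \<open>Q\<close> and \<open>C (v * \<tau>) * C (v / \<tau>)\<close>. Only the
  pseudo-covariance term distinguishes the two cases, so one general formula takes it as an
  unspecified product of a function of \<open>u\<close> and a function of \<open>v\<close>.\<close>

text \<open>Two one-dimensional scalings with Tonelli in between: \<open>t = s * v\<close> at fixed
  \<open>s\<close> contributes the factor \<open>s\<close>, then \<open>s = u / sqrt v\<close> at
  fixed \<open>v\<close> contributes \<open>1 / sqrt v\<close>. Together they give the Jacobian
  \<open>u / v\<close>.\<close>

lemma nn_integral_sqrt_quotient:
  fixes h :: "real \<times> real \<Rightarrow> ennreal"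
  assumes [measurable]: "h \<in> borel_measurable borel"
  shows "(\<integral>\<^sup>+p. indicator ({0<..} \<times> {0<..}) p * h p \<partial>lborel) =
    (\<integral>\<^sup>+(u, v). indicator ({0<..} \<times> {0<..}) (u, v) * ennreal (u / v) *
      h (u * sqrt v, u / sqrt v) \<partial>lborel)"
proof -
  have [measurable]: "h \<in> borel_measurable (borel \<Otimes>\<^sub>M borel)"
    using assms by (simp add: borel_prod)
  have scale: "(\<integral>\<^sup>+x. indicator {0<..} x * g x \<partial>lborel) =
      (\<integral>\<^sup>+x. indicator {0<..} x * (ennreal c * g (c * x)) \<partial>lborel)"
    if [measurable]: "g \<in> borel_measurable borel" and c: "c > 0" for g :: "real \<Rightarrow> ennreal" and c
  proof -
    have "(\<integral>\<^sup>+x. indicator {0<..} x * g x \<partial>lborel) =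
        \<bar>c\<bar> * (\<integral>\<^sup>+x. indicator {0<..} (0 + c * x) * g (0 + c * x) \<partial>lborel)"
      using c by (intro nn_integral_real_affine) auto
    also have "\<dots> = (\<integral>\<^sup>+x. ennreal c * (indicator {0<..} (c * x) * g (c * x)) \<partial>lborel)"
      using c by (simp add: nn_integral_cmult)
    also have "\<dots> = (\<integral>\<^sup>+x. indicator {0<..} x * (ennreal c * g (c * x)) \<partial>lborel)"
      using c by (intro nn_integral_cong) (auto simp: indicator_def zero_less_mult_iff)
    finally show ?thesis .
  qed
  have "(\<integral>\<^sup>+p. indicator ({0<..} \<times> {0<..}) p * h p \<partial>lborel) =
      (\<integral>\<^sup>+s. \<integral>\<^sup>+t. indicator ({0<..} \<times> {0<..}) (t, s) * h (t, s) \<partial>lborel \<partial>lborel)"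
    by (subst lborel_prod[symmetric], subst lborel_pair.nn_integral_snd[symmetric]) auto
  also have "\<dots> = (\<integral>\<^sup>+s. indicator {0<..} s * (\<integral>\<^sup>+t. indicator {0<..} t * h (t, s) \<partial>lborel) \<partial>lborel)"
    by (intro nn_integral_cong) (auto simp: indicator_def)
  also have "\<dots> = (\<integral>\<^sup>+s. indicator {0<..} s *
      (\<integral>\<^sup>+v. indicator {0<..} v * (ennreal s * h (s * v, s)) \<partial>lborel) \<partial>lborel)"
  proof (rule nn_integral_cong)
    fix s :: real
    show "indicator {0<..} s * (\<integral>\<^sup>+t. indicator {0<..} t * h (t, s) \<partial>lborel) = indicator {0<..} s *
      (\<integral>\<^sup>+v. indicator {0<..} v * (ennreal s * h (s * v, s)) \<partial>lborel)"
      by (cases "s > 0") (simp_all add: scale[of "\<lambda>t. h (t, s)" s])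
  qed
  also have "\<dots> = (\<integral>\<^sup>+s. \<integral>\<^sup>+v. indicator {0<..} s * (indicator {0<..} v * (ennreal s * h (s * v, s)))
      \<partial>lborel \<partial>lborel)"
    by (intro nn_integral_cong nn_integral_cmult[symmetric]) auto
  also have "\<dots> = (\<integral>\<^sup>+v. \<integral>\<^sup>+s. indicator {0<..} s * (indicator {0<..} v * (ennreal s * h (s * v, s)))
      \<partial>lborel \<partial>lborel)"
    by (intro lborel_pair.Fubini') auto
  also have "\<dots> = (\<integral>\<^sup>+v. \<integral>\<^sup>+u. indicator ({0<..} \<times> {0<..}) (u, v) *
      ennreal (u / v) * h (u * sqrt v, u / sqrt v) \<partial>lborel \<partial>lborel)"
  proof (rule nn_integral_cong)
    fix v :: real
    show "(\<integral>\<^sup>+s. indicator {0<..} s * (indicator {0<..} v * (ennreal s * h (s * v, s))) \<partial>lborel) =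
      (\<integral>\<^sup>+u. indicator ({0<..} \<times> {0<..}) (u, v) *
        ennreal (u / v) * h (u * sqrt v, u / sqrt v) \<partial>lborel)"
    proof (cases "v > 0")
      \<comment> \<open>Scaling by \<open>1 / sqrt v\<close> sends \<open>s * v\<close> to
        \<open>u * sqrt v\<close>, and the factor \<open>s\<close> left by the first scaling becomes
        \<open>u / sqrt v\<close>.\<close>
      case True
      have *: "x * v / sqrt v = x * sqrt v" for x
        using True by (metis less_eq_real_def real_div_sqrt times_divide_eq_right)
      have **: "u / sqrt v / sqrt v = u / v" for u
        using True by simp
      have "(\<integral>\<^sup>+s. indicator {0<..} s * (indicator {0<..} v * (ennreal s * h (s * v, s))) \<partial>lborel) =
        (\<integral>\<^sup>+u. indicator {0<..} u * (ennreal (1 / sqrt v) * (indicator {0<..} v *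
           (ennreal (1 / sqrt v * u) * h (1 / sqrt v * u * v, 1 / sqrt v * u)))) \<partial>lborel)"
        using True by (intro scale) auto
      also have "\<dots> = (\<integral>\<^sup>+u. indicator ({0<..} \<times> {0<..}) (u, v) *
        ennreal (u / v) * h (u * sqrt v, u / sqrt v) \<partial>lborel)"
        using True
        by (intro nn_integral_cong)
          (auto simp: indicator_def * mult.assoc[symmetric] ennreal_mult[symmetric] **)
      finally show ?thesis .
    qed simp
  qed
  also have "\<dots> = (\<integral>\<^sup>+(u, v). indicator ({0<..} \<times> {0<..}) (u, v) * ennreal (u / v) *
      h (u * sqrt v, u / sqrt v) \<partial>lborel)"
    by (subst lborel_prod[symmetric], subst lborel_pair.nn_integral_snd[symmetric]) auto
  finally show ?thesis .
qed

text \<open>As an identity of measures the change of variables carries over to complex integrands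
  through the rules for densities and image measures. It is enough to test it on indicators of Borel
  sets.\<close>

lemma distr_sqrt_quotient:
  "distr (density lborel (\<lambda>(u, v). indicator ({0<..} \<times> {0<..}) (u, v) * ennreal (u / v))) borel
     (\<lambda>(u, v). (u * sqrt v, u / sqrt v)) =
   density lborel (indicator ({0<..} \<times> {0<..}) :: real \<times> real \<Rightarrow> ennreal)"
  (is "distr ?N borel ?T = ?R")
proof (rule measure_eqI)
  fix B assume "B \<in> sets (distr ?N borel ?T)"
  then have B[measurable]: "B \<in> sets borel" by simp
  have T[measurable]: "?T \<in> borel \<rightarrow>\<^sub>M borel"
    unfolding borel_prod[symmetric] by measurable
  have d[measurable]: "(\<lambda>(u, v). indicator ({0<..} \<times> {0<..}) (u, v) * ennreal (u / v))
      \<in> borel_measurable (borel :: (real \<times> real) measure)"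
    unfolding borel_prod[symmetric] by measurable
  have i[measurable]: "(indicator ({0<..} \<times> {0<..}) :: real \<times> real \<Rightarrow> ennreal) \<in> borel_measurable borel"
    unfolding borel_prod[symmetric] by measurable
  have "emeasure (distr ?N borel ?T) B = (\<integral>\<^sup>+p. indicator B p \<partial>distr ?N borel ?T)"
    by simp
  also have "\<dots> = (\<integral>\<^sup>+p. indicator B (?T p) \<partial>?N)"
    by (intro nn_integral_distr) auto
  also have "\<dots> = (\<integral>\<^sup>+p. (case p of (u, v) \<Rightarrow> indicator ({0<..} \<times> {0<..}) (u, v) * ennreal (u / v)) *
      indicator B (?T p) \<partial>lborel)"
    by (intro nn_integral_density) auto
  also have "\<dots> = (\<integral>\<^sup>+p. indicator ({0<..} \<times> {0<..}) p * indicator B p \<partial>lborel)"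
    by (subst nn_integral_sqrt_quotient) (auto intro!: nn_integral_cong)
  also have "\<dots> = (\<integral>\<^sup>+p. indicator B p \<partial>?R)"
    by (intro nn_integral_density[symmetric]) auto
  finally show "emeasure (distr ?N borel ?T) B = emeasure ?R B" by simp
qed simp

section \<open>Integrals of separated functions over the quadrant\<close>

lemma has_bochner_integral_mult_pair:
  fixes f g :: "real \<Rightarrow> complex"
  assumes f: "integrable lborel f" and g: "integrable lborel g"
  shows "has_bochner_integral lborel (\<lambda>(x, y). f x * g y) (integral\<^sup>L lborel f * integral\<^sup>L lborel g)"
proof -
  have [measurable]: "f \<in> borel_measurable borel" "g \<in> borel_measurable borel"
    using f g by auto
  have int: "integrable (lborel \<Otimes>\<^sub>M lborel) (\<lambda>(x, y). f x * g y)"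
  proof (rule lborel_pair.Fubini_integrable)
    show "integrable lborel (\<lambda>x. \<integral>y. norm (case (x, y) of (x, y) \<Rightarrow> f x * g y) \<partial>lborel)"
      using f by (simp add: norm_mult)
  qed (use g in auto)
  have "(\<integral>p. (case p of (x, y) \<Rightarrow> f x * g y) \<partial>(lborel \<Otimes>\<^sub>M lborel)) =
      (\<integral>x. \<integral>y. f x * g y \<partial>lborel \<partial>lborel)"
    using lborel_pair.integral_fst'[OF int] by simp
  then show ?thesis
    using int by (simp add: has_bochner_integral_iff lborel_prod)
qed

lemma has_bochner_integral_mult_quadrant:
  fixes f g :: "real \<Rightarrow> complex"
  assumes "set_integrable lborel {0<..} f" "set_integrable lborel {0<..} g"
    and "\<And>x y. 0 < x \<Longrightarrow> 0 < y \<Longrightarrow> K (x, y) = f x * g y"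
  shows "has_bochner_integral lborel (\<lambda>p. indicator ({0<..} \<times> {0<..}) p *\<^sub>R K p)
    ((LINT x:{0<..}|lborel. f x) * (LINT x:{0<..}|lborel. g x))"
proof -
  have eq: "(\<lambda>p. indicator ({0<..} \<times> {0<..}) p *\<^sub>R K p) =
      (\<lambda>(x, y). (indicator {0<..} x *\<^sub>R f x) * (indicator {0<..} y *\<^sub>R g y))"
    using assms(3) by (auto simp: indicator_def fun_eq_iff)
  show ?thesis
    unfolding eq set_lebesgue_integral_def
    using assms(1,2) unfolding set_integrable_def by (rule has_bochner_integral_mult_pair)
qed

text \<open>The weight \<open>t / (s * sqrt (t * s))\<close> equals \<open>v / u\<close>, the
  reciprocal of the Jacobian, so after the substitution just \<open>f u * g v\<close> is left and
  Fubini applies.\<close>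

lemma has_bochner_integral_sqrt_quotient:
  fixes f g :: "real \<Rightarrow> complex"
  assumes f: "set_integrable lborel {0<..} f" and g: "set_integrable lborel {0<..} g"
    and K: "\<And>t s. 0 < t \<Longrightarrow> 0 < s \<Longrightarrow>
      K (t, s) = f (sqrt (t * s)) * g (t / s) * complex_of_real (t / (s * sqrt (t * s)))"
  shows "has_bochner_integral lborel (\<lambda>p. indicator ({0<..} \<times> {0<..}) p *\<^sub>R K p)
    ((LINT x:{0<..}|lborel. f x) * (LINT x:{0<..}|lborel. g x))"
proof -
  \<comment> \<open>Integrability on the half-line gives measurability only after extension by zero;
    the extended functions make \<open>k\<close> Borel on the whole plane.\<close>
  define f' where "f' x = indicator {0<..} x *\<^sub>R f x" for x
  define g' where "g' x = indicator {0<..} x *\<^sub>R g x" for x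
  have [measurable]: "f' \<in> borel_measurable borel" "g' \<in> borel_measurable borel"
    using f g by (auto simp: set_integrable_def f'_def[abs_def] g'_def[abs_def] dest: borel_measurable_integrable)
  define k :: "real \<times> real \<Rightarrow> complex" where
    "k = (\<lambda>(t, s). f' (sqrt (t * s)) * g' (t / s) * complex_of_real (t / (s * sqrt (t * s))))"
  have k[measurable]: "k \<in> borel_measurable borel"
    unfolding k_def borel_prod[symmetric] by measurable
  have T[measurable]: "(\<lambda>(u, v). (u * sqrt v, u / sqrt v)) \<in> borel \<rightarrow>\<^sub>M (borel :: (real \<times> real) measure)"
    unfolding borel_prod[symmetric] by measurable
  have i[measurable]: "(indicator ({0<..} \<times> {0<..}) :: real \<times> real \<Rightarrow> real) \<in> borel_measurable borel"
    unfolding borel_prod[symmetric] by measurable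
  have d[measurable]: "(\<lambda>(u, v). indicator ({0<..} \<times> {0<..}) (u, v) * (u / v))
      \<in> borel_measurable (borel :: (real \<times> real) measure)"
    unfolding borel_prod[symmetric] by measurable
  have w: "0 \<le> (case p of (u, v) \<Rightarrow> indicator ({0<..} \<times> {0<..}) (u, v) * (u / v))" for p :: "real \<times> real"
    by (cases p) (auto simp: indicator_def)
  let ?I = "(LINT x:{0<..}|lborel. f x) * (LINT x:{0<..}|lborel. g x)"
  let ?N = "density lborel (\<lambda>(u, v). indicator ({0<..} \<times> {0<..}) (u, v) * ennreal (u / v))"
  \<comment> \<open>The Bochner rules for densities expect a weight of the form
    \<open>ennreal\<close> of a real function; the same is done for \<open>?R\<close> below.\<close>
  have N: "?N = density lborel (\<lambda>p. ennreal (case p of (u, v) \<Rightarrow> indicator ({0<..} \<times> {0<..}) (u, v) * (u / v)))"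
    by (intro arg_cong2[where f = density]) (auto simp: indicator_def fun_eq_iff)
  have R: "density lborel (indicator ({0<..} \<times> {0<..}) :: real \<times> real \<Rightarrow> ennreal) =
      density lborel (\<lambda>p. ennreal (indicator ({0<..} \<times> {0<..}) p))"
    by (intro arg_cong2[where f = density]) (auto simp: indicator_def fun_eq_iff)
  have "has_bochner_integral lborel (\<lambda>(u, v). f' u * g' v) ?I"
    unfolding set_lebesgue_integral_def f'_def[symmetric] g'_def[symmetric]
    using f g unfolding set_integrable_def f'_def[symmetric] g'_def[symmetric]
    by (intro has_bochner_integral_mult_pair) auto
  also have "(\<lambda>(u, v). f' u * g' v) = (\<lambda>p. (case p of (u, v) \<Rightarrow> indicator ({0<..} \<times> {0<..}) (u, v) * (u / v))
      *\<^sub>R k (case p of (u, v) \<Rightarrow> (u * sqrt v, u / sqrt v)))"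
  proof (rule ext, clarify)
    fix u v :: real
    show "f' u * g' v = (indicator ({0<..} \<times> {0<..}) (u, v) * (u / v)) *\<^sub>R k (u * sqrt v, u / sqrt v)"
    proof (cases "u > 0 \<and> v > 0")
      case True
      then have "u * sqrt v * (u / sqrt v) = u\<^sup>2" "u * sqrt v / (u / sqrt v) = v"
        by (auto simp: field_simps power2_eq_square)
      then have "k (u * sqrt v, u / sqrt v) = f' u * g' v * complex_of_real (v / u)"
        using True by (simp add: k_def flip: divide_divide_eq_left del: of_real_divide of_real_mult)
      with True show ?thesis
        by (simp add: scaleR_conv_of_real)
    qed (auto simp: f'_def g'_def)
  qed
  finally have "has_bochner_integral ?N (\<lambda>p. k (case p of (u, v) \<Rightarrow> (u * sqrt v, u / sqrt v))) ?I"
    unfolding N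
    using measurable_compose[OF T k] d w
    by (subst has_bochner_integral_density) (auto simp del: indicator_simps times_divide_eq_right)
  then have "has_bochner_integral (distr ?N borel (\<lambda>(u, v). (u * sqrt v, u / sqrt v))) k ?I"
    by (subst has_bochner_integral_distr) auto
  then have "has_bochner_integral lborel (\<lambda>p. indicator ({0<..} \<times> {0<..}) p *\<^sub>R k p) ?I"
    unfolding distr_sqrt_quotient R
    by (simp add: has_bochner_integral_iff integrable_density integral_density)
  also have "(\<lambda>p. indicator ({0<..} \<times> {0<..}) p *\<^sub>R k p) = (\<lambda>p. indicator ({0<..} \<times> {0<..}) p *\<^sub>R K p)"
    by (auto simp: fun_eq_iff indicator_def k_def K f'_def g'_def)
  finally show ?thesis .
qed

subsection \<open>Isserlis' theorem\<close>

text \<open>This is the one-dimensional information that remains of Gaussianity: a real linear space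
  whose members have the second and fourth moments of a centred normal variable.\<close>

locale isserlis_space =
  fixes M :: "'a measure" and G :: "('a \<Rightarrow> real) set"
  assumes add: "f \<in> G \<Longrightarrow> g \<in> G \<Longrightarrow> (\<lambda>\<omega>. f \<omega> + g \<omega>) \<in> G"
    and scale: "f \<in> G \<Longrightarrow> (\<lambda>\<omega>. c * f \<omega>) \<in> G"
    and moment2: "f \<in> G \<Longrightarrow> integrable M (\<lambda>\<omega>. (f \<omega>)\<^sup>2)"
    and moment4: "f \<in> G \<Longrightarrow> integrable M (\<lambda>\<omega>. f \<omega> ^ 4)"
    and kurtosis: "f \<in> G \<Longrightarrow> (\<integral>\<omega>. f \<omega> ^ 4 \<partial>M) = 3 * (\<integral>\<omega>. (f \<omega>)\<^sup>2 \<partial>M)\<^sup>2"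
begin

text \<open>The set is closed under conjugation, so conjugated factors can be treated like any
  others, and Isserlis' theorem becomes a statement about the bilinear form \<open>E (Y * Z)\<close>
  rather than a sesquilinear one.\<close>

definition complexified :: "('a \<Rightarrow> complex) set" where
  "complexified = {Z. (\<lambda>\<omega>. Re (Z \<omega>)) \<in> G \<and> (\<lambda>\<omega>. Im (Z \<omega>)) \<in> G}"

lemma complexified_add:
  "Y \<in> complexified \<Longrightarrow> Z \<in> complexified \<Longrightarrow> (\<lambda>\<omega>. Y \<omega> + Z \<omega>) \<in> complexified"
  by (simp add: complexified_def add)

lemma complexified_diff:
  "Y \<in> complexified \<Longrightarrow> Z \<in> complexified \<Longrightarrow> (\<lambda>\<omega>. Y \<omega> - Z \<omega>) \<in> complexified"
  unfolding complexified_def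
  using add[OF _ scale[of _ "-1"]] by simp

lemma complexified_scale:
  "Z \<in> complexified \<Longrightarrow> (\<lambda>\<omega>. of_real c * Z \<omega>) \<in> complexified"
  by (simp add: complexified_def scale)

text \<open>The kurtosis identity for \<open>a * Re Z + b * Im Z\<close> is a polynomial identity in
  \<open>a\<close> and \<open>b\<close>, hence should persist at \<open>a = 1\<close>,
  \<open>b = \<i>\<close>. This is made explicit by interpolation: the powers of \<open>Z\<close>
  are complex combinations of powers of real combinations \<open>L a b\<close>, to which the real
  identity applies.\<close>

lemma complexified_moments:
  assumes "Z \<in> complexified"
  shows "integrable M (\<lambda>\<omega>. (Z \<omega>)\<^sup>2)" "integrable M (\<lambda>\<omega>. Z \<omega> ^ 4)"
    "(\<integral>\<omega>. Z \<omega> ^ 4 \<partial>M) = 3 * (\<integral>\<omega>. (Z \<omega>)\<^sup>2 \<partial>M)\<^sup>2"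
proof -
  define L where "L a b \<omega> = a * Re (Z \<omega>) + b * Im (Z \<omega>)" for a b \<omega>
  have G: "L a b \<in> G" for a b
    using assms add[OF scale scale] unfolding complexified_def L_def[abs_def] by blast
  define m where "m a b = (\<integral>\<omega>. (L a b \<omega>)\<^sup>2 \<partial>M)" for a b
  have i2: "integrable M (\<lambda>\<omega>. complex_of_real ((L a b \<omega>)\<^sup>2))" for a b
    using moment2[OF G] by (rule integrable_of_real)
  have i4: "integrable M (\<lambda>\<omega>. complex_of_real (L a b \<omega> ^ 4))" for a b
    using moment4[OF G] by (rule integrable_of_real)
  have e2: "(\<integral>\<omega>. complex_of_real ((L a b \<omega>)\<^sup>2) \<partial>M) = of_real (m a b)" for a b
    by (simp add: m_def flip: of_real_power)
  have e4: "(\<integral>\<omega>. complex_of_real (L a b \<omega> ^ 4) \<partial>M) = of_real (3 * (m a b)\<^sup>2)" for a b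
    by (simp add: m_def kurtosis[OF G] flip: of_real_power)
  \<comment> \<open>The second moment is a quadratic form in \<open>(a, b)\<close>; its cross
    coefficient \<open>2 * E (Re Z * Im Z)\<close> is read off from
    \<open>m 1 1 - m 1 (-1)\<close>.\<close>
  have mm: "m a b = a\<^sup>2 * m 1 0 + b\<^sup>2 * m 0 1 + a * b * ((m 1 1 - m 1 (-1)) / 2)" for a b
  proof -
    have "(L a b \<omega>)\<^sup>2 = a\<^sup>2 * (L 1 0 \<omega>)\<^sup>2 + b\<^sup>2 * (L 0 1 \<omega>)\<^sup>2
        + a * b * (((L 1 1 \<omega>)\<^sup>2 - (L 1 (-1) \<omega>)\<^sup>2) / 2)" for \<omega>
      by (simp add: L_def power2_eq_square algebra_simps)
    then show ?thesis
      unfolding m_def by (simp add: moment2[OF G])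
  qed
  have Z2: "(Z \<omega>)\<^sup>2 = complex_of_real ((L 1 0 \<omega>)\<^sup>2) - complex_of_real ((L 0 1 \<omega>)\<^sup>2)
      + \<i> / 2 * (complex_of_real ((L 1 1 \<omega>)\<^sup>2) - complex_of_real ((L 1 (-1) \<omega>)\<^sup>2))" for \<omega>
    by (simp add: complex_eq_iff L_def power2_eq_square algebra_simps)
  \<comment> \<open>With \<open>x = Re Z\<close> and \<open>y = Im Z\<close>, sums over the slopes 1
    and -1 produce the even terms. The odd part \<open>4 * x^3 * y - 4 * x * y^3\<close> has two
    unknown monomials and needs a second slope 2; solving the linear system gives the coefficients
    \<open>5 / 6\<close> and \<open>-1 / 6\<close>.\<close>
  have Z4: "Z \<omega> ^ 4 = 2 * complex_of_real (L 1 0 \<omega> ^ 4) + 2 * complex_of_real (L 0 1 \<omega> ^ 4)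
      - 1 / 2 * (complex_of_real (L 1 1 \<omega> ^ 4) + complex_of_real (L 1 (-1) \<omega> ^ 4))
      + \<i> * 5 / 6 * (complex_of_real (L 1 1 \<omega> ^ 4) - complex_of_real (L 1 (-1) \<omega> ^ 4))
      - \<i> / 6 * (complex_of_real (L 1 2 \<omega> ^ 4) - complex_of_real (L 1 (-2) \<omega> ^ 4))" for \<omega>
    by (simp add: complex_eq_iff L_def eval_nat_numeral algebra_simps)
  show "integrable M (\<lambda>\<omega>. (Z \<omega>)\<^sup>2)"
    unfolding Z2 by (intro Bochner_Integration.integrable_add Bochner_Integration.integrable_diff integrable_mult_right i2)
  show "integrable M (\<lambda>\<omega>. Z \<omega> ^ 4)"
    unfolding Z4 by (intro Bochner_Integration.integrable_add Bochner_Integration.integrable_diff integrable_mult_right i4)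
  have E2: "(\<integral>\<omega>. (Z \<omega>)\<^sup>2 \<partial>M) = of_real (m 1 0) - of_real (m 0 1)
      + \<i> / 2 * (of_real (m 1 1) - of_real (m 1 (-1)))"
    unfolding Z2 by (simp only: i2 e2 Bochner_Integration.integral_add Bochner_Integration.integral_diff Bochner_Integration.integrable_add Bochner_Integration.integrable_diff
        integral_mult_right_zero integrable_mult_right)
  have E4: "(\<integral>\<omega>. Z \<omega> ^ 4 \<partial>M) = 2 * of_real (3 * (m 1 0)\<^sup>2) + 2 * of_real (3 * (m 0 1)\<^sup>2)
      - 1 / 2 * (of_real (3 * (m 1 1)\<^sup>2) + of_real (3 * (m 1 (-1))\<^sup>2))
      + \<i> * 5 / 6 * (of_real (3 * (m 1 1)\<^sup>2) - of_real (3 * (m 1 (-1))\<^sup>2))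
      - \<i> / 6 * (of_real (3 * (m 1 2)\<^sup>2) - of_real (3 * (m 1 (-2))\<^sup>2))"
    unfolding Z4 by (simp only: i4 e4 Bochner_Integration.integral_add Bochner_Integration.integral_diff Bochner_Integration.integrable_add Bochner_Integration.integrable_diff
        integral_mult_right_zero integrable_mult_right)
  define d where "d = (m 1 1 - m 1 (-1)) / 2"
  have me: "m 1 1 = m 1 0 + m 0 1 + d" "m 1 (-1) = m 1 0 + m 0 1 - d"
    "m 1 2 = m 1 0 + 4 * m 0 1 + 2 * d" "m 1 (-2) = m 1 0 + 4 * m 0 1 - 2 * d"
    using mm[of 1 1, folded d_def] mm[of 1 "-1", folded d_def]
      mm[of 1 2, folded d_def] mm[of 1 "-2", folded d_def] by simp_all
  \<comment> \<open>Everything is now expressed in the three independent quantities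
    \<open>m 1 0\<close>, \<open>m 0 1\<close> and \<open>d\<close>, in which the claim is a
    polynomial identity.\<close>
  show "(\<integral>\<omega>. Z \<omega> ^ 4 \<partial>M) = 3 * (\<integral>\<omega>. (Z \<omega>)\<^sup>2 \<partial>M)\<^sup>2"
    unfolding E2 E4 me by (simp add: complex_eq_iff power2_eq_square algebra_simps)
qed

lemma complexified_integrable_mult:
  assumes "Y \<in> complexified" "Z \<in> complexified"
  shows "integrable M (\<lambda>\<omega>. Y \<omega> * Z \<omega>)"
proof -
  have "integrable M (\<lambda>\<omega>. 1 / 4 * ((Y \<omega> + Z \<omega>)\<^sup>2 - (Y \<omega> - Z \<omega>)\<^sup>2))"
    using assms by (intro integrable_mult_right Bochner_Integration.integrable_diff complexified_moments(1)
      complexified_add complexified_diff)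
  moreover have "1 / 4 * ((Y \<omega> + Z \<omega>)\<^sup>2 - (Y \<omega> - Z \<omega>)\<^sup>2) = Y \<omega> * Z \<omega>" for \<omega>
    by (simp add: power2_eq_square algebra_simps)
  ultimately show ?thesis
    by (simp only:)
qed

text \<open>By polarisation: the eight sign choices isolate the coefficient of \<open>Z1 * Z2 * Z3 * Z4\<close> in a
  fourth power, on both sides of the kurtosis identity.\<close>

lemma isserlis:
  assumes Z: "Z1 \<in> complexified" "Z2 \<in> complexified" "Z3 \<in> complexified" "Z4 \<in> complexified"
  shows "(\<integral>\<omega>. Z1 \<omega> * Z2 \<omega> * Z3 \<omega> * Z4 \<omega> \<partial>M) =
      (\<integral>\<omega>. Z1 \<omega> * Z2 \<omega> \<partial>M) * (\<integral>\<omega>. Z3 \<omega> * Z4 \<omega> \<partial>M) +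
      (\<integral>\<omega>. Z1 \<omega> * Z3 \<omega> \<partial>M) * (\<integral>\<omega>. Z2 \<omega> * Z4 \<omega> \<partial>M) +
      (\<integral>\<omega>. Z1 \<omega> * Z4 \<omega> \<partial>M) * (\<integral>\<omega>. Z2 \<omega> * Z3 \<omega> \<partial>M)"
proof -
  note i =
    complexified_integrable_mult[OF Z(1) Z(1)]    complexified_integrable_mult[OF Z(2) Z(2)]
    complexified_integrable_mult[OF Z(3) Z(3)]    complexified_integrable_mult[OF Z(4) Z(4)]
    complexified_integrable_mult[OF Z(1) Z(2)]    complexified_integrable_mult[OF Z(1) Z(3)]
    complexified_integrable_mult[OF Z(1) Z(4)]    complexified_integrable_mult[OF Z(2) Z(3)]
    complexified_integrable_mult[OF Z(2) Z(4)]    complexified_integrable_mult[OF Z(3) Z(4)]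
  define W where "W a b c \<omega> = Z1 \<omega> + of_real a * Z2 \<omega> + of_real b * Z3 \<omega> + of_real c * Z4 \<omega>"
    for a b c :: real and \<omega>
  have W: "W a b c \<in> complexified" for a b c
    unfolding W_def[abs_def] using Z by (intro complexified_add complexified_scale)
  define p where "p Y Z = (\<integral>\<omega>. Y \<omega> * Z \<omega> \<partial>M)" for Y Z :: "'a \<Rightarrow> complex"
  have W2: "(\<integral>\<omega>. (W a b c \<omega>)\<^sup>2 \<partial>M) = p Z1 Z1 + of_real (a\<^sup>2) * p Z2 Z2 + of_real (b\<^sup>2) * p Z3 Z3
      + of_real (c\<^sup>2) * p Z4 Z4 + of_real (2 * a) * p Z1 Z2 + of_real (2 * b) * p Z1 Z3
      + of_real (2 * c) * p Z1 Z4 + of_real (2 * a * b) * p Z2 Z3 + of_real (2 * a * c) * p Z2 Z4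
      + of_real (2 * b * c) * p Z3 Z4" for a b c
  proof -
    have "(W a b c \<omega>)\<^sup>2 = Z1 \<omega> * Z1 \<omega> + of_real (a\<^sup>2) * (Z2 \<omega> * Z2 \<omega>) + of_real (b\<^sup>2) * (Z3 \<omega> * Z3 \<omega>)
        + of_real (c\<^sup>2) * (Z4 \<omega> * Z4 \<omega>) + of_real (2 * a) * (Z1 \<omega> * Z2 \<omega>) + of_real (2 * b) * (Z1 \<omega> * Z3 \<omega>)
        + of_real (2 * c) * (Z1 \<omega> * Z4 \<omega>) + of_real (2 * a * b) * (Z2 \<omega> * Z3 \<omega>)
        + of_real (2 * a * c) * (Z2 \<omega> * Z4 \<omega>) + of_real (2 * b * c) * (Z3 \<omega> * Z4 \<omega>)" for \<omega>
      by (simp add: W_def power2_eq_square algebra_simps)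
    then show ?thesis
      unfolding p_def
      by (simp only:) (intro has_bochner_integral_integral_eq has_bochner_integral_add
        has_bochner_integral_mult_right has_bochner_integral_integrable i)
  qed
  have W4: "(\<integral>\<omega>. W a b c \<omega> ^ 4 \<partial>M) = 3 * (\<integral>\<omega>. (W a b c \<omega>)\<^sup>2 \<partial>M)\<^sup>2"
    and i4: "integrable M (\<lambda>\<omega>. W a b c \<omega> ^ 4)" for a b c
    using complexified_moments(2,3)[OF W] by simp_all
  \<comment> \<open>Each sign choice is weighted by the product \<open>a * b * c\<close>. The
    constant is \<open>192 = 8 * 24\<close>: eight sign choices times the multinomial coefficient
    \<open>4!\<close> of the mixed monomial.\<close>
  have "Z1 \<omega> * Z2 \<omega> * Z3 \<omega> * Z4 \<omega> = 1 / 192 * (W 1 1 1 \<omega> ^ 4 - W 1 1 (-1) \<omega> ^ 4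
      - W 1 (-1) 1 \<omega> ^ 4 + W 1 (-1) (-1) \<omega> ^ 4 - W (-1) 1 1 \<omega> ^ 4 + W (-1) 1 (-1) \<omega> ^ 4
      + W (-1) (-1) 1 \<omega> ^ 4 - W (-1) (-1) (-1) \<omega> ^ 4)" for \<omega>
    by (simp add: W_def eval_nat_numeral algebra_simps)
  then have "(\<integral>\<omega>. Z1 \<omega> * Z2 \<omega> * Z3 \<omega> * Z4 \<omega> \<partial>M) = (\<integral>\<omega>. 1 / 192 * (W 1 1 1 \<omega> ^ 4 - W 1 1 (-1) \<omega> ^ 4
      - W 1 (-1) 1 \<omega> ^ 4 + W 1 (-1) (-1) \<omega> ^ 4 - W (-1) 1 1 \<omega> ^ 4 + W (-1) 1 (-1) \<omega> ^ 4
      + W (-1) (-1) 1 \<omega> ^ 4 - W (-1) (-1) (-1) \<omega> ^ 4) \<partial>M)"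
    by (simp only:)
  also have "\<dots> = 1 / 192 * ((\<integral>\<omega>. W 1 1 1 \<omega> ^ 4 \<partial>M) - (\<integral>\<omega>. W 1 1 (-1) \<omega> ^ 4 \<partial>M)
      - (\<integral>\<omega>. W 1 (-1) 1 \<omega> ^ 4 \<partial>M) + (\<integral>\<omega>. W 1 (-1) (-1) \<omega> ^ 4 \<partial>M)
      - (\<integral>\<omega>. W (-1) 1 1 \<omega> ^ 4 \<partial>M) + (\<integral>\<omega>. W (-1) 1 (-1) \<omega> ^ 4 \<partial>M)
      + (\<integral>\<omega>. W (-1) (-1) 1 \<omega> ^ 4 \<partial>M) - (\<integral>\<omega>. W (-1) (-1) (-1) \<omega> ^ 4 \<partial>M))"
    by (simp only: i4 Bochner_Integration.integral_add Bochner_Integration.integral_diff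
        Bochner_Integration.integrable_add Bochner_Integration.integrable_diff integral_mult_right_zero)
  \<comment> \<open>On the squared quadratic form \<open>W2\<close> the signed sum keeps only terms
    with \<open>a * b * c\<close>. Each pairing occurs there with coefficient
    \<open>2 * 2 * 2 = 8\<close>, and \<open>3 * 8 * 8 = 192\<close> cancels the constant.\<close>
  also have "\<dots> = p Z1 Z2 * p Z3 Z4 + p Z1 Z3 * p Z2 Z4 + p Z1 Z4 * p Z2 Z3"
    unfolding W4 W2 by (simp add: power2_eq_square algebra_simps)
  finally show ?thesis
    by (simp add: p_def)
qed

end

subsection \<open>Moments of Gaussian processes\<close>

text \<open>Zero mean forces the location parameter to vanish in the nondegenerate case. In the
  degenerate case it forces the variable to be almost surely zero, and both sides of the identity
  are zero.\<close>

lemma gaussian_rv_moments: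
  assumes "prob_space M" and Y: "gaussian_rv M Y" and mean: "(\<integral>\<omega>. Y \<omega> \<partial>M) = 0"
  shows "integrable M (\<lambda>\<omega>. (Y \<omega>)\<^sup>2)" "integrable M (\<lambda>\<omega>. Y \<omega> ^ 4)"
    "(\<integral>\<omega>. Y \<omega> ^ 4 \<partial>M) = 3 * (\<integral>\<omega>. (Y \<omega>)\<^sup>2 \<partial>M)\<^sup>2"
proof -
  interpret prob_space M by fact
  have [measurable]: "Y \<in> borel_measurable M"
    using Y by (simp add: gaussian_rv_def)
  consider \<mu> \<sigma> where "0 < \<sigma>" "distributed M lborel Y (\<lambda>x. ennreal (normal_density \<mu> \<sigma> x))"
    | \<mu> where "AE \<omega> in M. Y \<omega> = \<mu>"
    using Y unfolding gaussian_rv_def by blast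
  then have "integrable M (\<lambda>\<omega>. (Y \<omega>)\<^sup>2) \<and> integrable M (\<lambda>\<omega>. Y \<omega> ^ 4) \<and>
      (\<integral>\<omega>. Y \<omega> ^ 4 \<partial>M) = 3 * (\<integral>\<omega>. (Y \<omega>)\<^sup>2 \<partial>M)\<^sup>2"
  proof cases
    case 1
    then have D: "distributed M lborel Y (\<lambda>x. ennreal (normal_density 0 \<sigma> x))"
      using normal_distributed_expectation[of \<sigma> Y \<mu>] mean by simp
    \<comment> \<open>The even moments are \<open>(2k)! / (k! * (2 / \<sigma>^2)^k)\<close>; at
      \<open>k = 2\<close> this gives the kurtosis constant
      \<open>4! / (2! * 2^2) = 3\<close>.\<close>
    have m: "has_bochner_integral lborel (\<lambda>x. normal_density 0 \<sigma> x * x ^ 2) (\<sigma>\<^sup>2)"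
      "has_bochner_integral lborel (\<lambda>x. normal_density 0 \<sigma> x * x ^ 4) (3 * \<sigma> ^ 4)"
      using normal_moment_even[OF \<open>0 < \<sigma>\<close>, of 0 1] normal_moment_even[OF \<open>0 < \<sigma>\<close>, of 0 2]
      by (simp_all add: fact_numeral power_divide)
    have "integrable M (\<lambda>\<omega>. Y \<omega> ^ k) \<longleftrightarrow> integrable lborel (\<lambda>x. normal_density 0 \<sigma> x * x ^ k)"
      "(\<integral>\<omega>. Y \<omega> ^ k \<partial>M) = (\<integral>x. normal_density 0 \<sigma> x * x ^ k \<partial>lborel)" for k
      using distributed_integrable[OF D, of "\<lambda>x. x ^ k"] distributed_integral[OF D, of "\<lambda>x. x ^ k"]
      by simp_all
    with m show ?thesis
      by (simp add: has_bochner_integral_iff)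
  next
    case 2
    have "(\<integral>\<omega>. Y \<omega> \<partial>M) = (\<integral>\<omega>. \<mu> \<partial>M)"
      using 2 by (intro integral_cong_AE) auto
    then have "AE \<omega> in M. Y \<omega> = 0"
      using 2 mean by (simp add: prob_space)
    then have zero: "AE \<omega> in M. Y \<omega> ^ k = 0" if "k \<noteq> 0" for k
      using that by auto
    then have "integrable M (\<lambda>\<omega>. Y \<omega> ^ k)" "(\<integral>\<omega>. Y \<omega> ^ k \<partial>M) = 0" if "k \<noteq> 0" for k
      using that integrable_cong_AE[of "\<lambda>\<omega>. Y \<omega> ^ k" M "\<lambda>_. 0"] by (auto intro: integral_eq_zero_AE)
    then show ?thesis by simp
  qed
  then show "integrable M (\<lambda>\<omega>. (Y \<omega>)\<^sup>2)" "integrable M (\<lambda>\<omega>. Y \<omega> ^ 4)"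
    "(\<integral>\<omega>. Y \<omega> ^ 4 \<partial>M) = 3 * (\<integral>\<omega>. (Y \<omega>)\<^sup>2 \<partial>M)\<^sup>2"
    by blast+
qed

section \<open>The real linear span of a Gaussian process\<close>

text \<open>Exactly the family of variables that \<open>gaussian_process\<close> declares Gaussian.
  The coefficients are complex, so the real and imaginary parts of every \<open>X t\<close> belong
  to it.\<close>

definition real_span :: "(real \<Rightarrow> 'a \<Rightarrow> complex) \<Rightarrow> ('a \<Rightarrow> real) set" where
  "real_span X = {(\<lambda>\<omega>. Re (\<Sum>t\<in>F. c t * X t \<omega>)) |F c. finite F \<and> F \<subseteq> {0<..}}"

lemma real_spanI:
  "finite F \<Longrightarrow> F \<subseteq> {0<..} \<Longrightarrow> (\<lambda>\<omega>. Re (\<Sum>t\<in>F. c t * X t \<omega>)) \<in> real_span X"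
  unfolding real_span_def by blast

lemma real_span_singleton: "0 < t \<Longrightarrow> (\<lambda>\<omega>. Re (c * X t \<omega>)) \<in> real_span X"
  using real_spanI[of "{t}" "\<lambda>_. c" X] by simp

lemma isserlis_space_gaussian_process:
  assumes "prob_space M" "gaussian_process M X" "zero_mean M X"
  shows "isserlis_space M (real_span X)"
proof
  fix f g :: "'a \<Rightarrow> real" and c :: real
  assume f: "f \<in> real_span X"
  then obtain F a where F: "finite F" "F \<subseteq> {0<..}" "f = (\<lambda>\<omega>. Re (\<Sum>t\<in>F. a t * X t \<omega>))"
    unfolding real_span_def by blast
  have "(\<lambda>\<omega>. c * f \<omega>) = (\<lambda>\<omega>. Re (\<Sum>t\<in>F. (of_real c * a t) * X t \<omega>))"
    by (simp add: F(3) mult.assoc sum_distrib_left right_diff_distrib)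
  then show "(\<lambda>\<omega>. c * f \<omega>) \<in> real_span X"
    using F(1,2) by (simp only: real_spanI)
  have int: "integrable M (\<lambda>\<omega>. a t * X t \<omega>)" "(\<integral>\<omega>. a t * X t \<omega> \<partial>M) = 0" if "t \<in> F" for t
    using assms(3) F(2) that by (auto simp: zero_mean_def)
  have "gaussian_rv M f"
    using assms(2) F unfolding gaussian_process_def by blast
  moreover have "(\<integral>\<omega>. f \<omega> \<partial>M) = Re (\<integral>\<omega>. (\<Sum>t\<in>F. a t * X t \<omega>) \<partial>M)"
    unfolding F(3) using int by (intro integral_Re Bochner_Integration.integrable_sum)
  moreover have "(\<integral>\<omega>. (\<Sum>t\<in>F. a t * X t \<omega>) \<partial>M) = (\<Sum>t\<in>F. \<integral>\<omega>. a t * X t \<omega> \<partial>M)"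
    by (intro Bochner_Integration.integral_sum int(1))
  moreover have "\<dots> = 0"
    by (intro sum.neutral ballI int(2))
  ultimately have "gaussian_rv M f" "(\<integral>\<omega>. f \<omega> \<partial>M) = 0"
    by (simp_all only: zero_complex.sel)
  then show "integrable M (\<lambda>\<omega>. (f \<omega>)\<^sup>2)" "integrable M (\<lambda>\<omega>. f \<omega> ^ 4)"
    "(\<integral>\<omega>. f \<omega> ^ 4 \<partial>M) = 3 * (\<integral>\<omega>. (f \<omega>)\<^sup>2 \<partial>M)\<^sup>2"
    using gaussian_rv_moments[OF assms(1)] by blast+
  assume "g \<in> real_span X"
  then obtain G b where G: "finite G" "G \<subseteq> {0<..}" "g = (\<lambda>\<omega>. Re (\<Sum>t\<in>G. b t * X t \<omega>))"
    unfolding real_span_def by blast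
  \<comment> \<open>Coefficients are extended by zero to the union of the index sets, so that they
    add up where the sets overlap.\<close>
  define d where "d t = (if t \<in> F then a t else 0) + (if t \<in> G then b t else 0)" for t
  have "(\<Sum>t\<in>F \<union> G. d t * X t \<omega>) = (\<Sum>t\<in>F. a t * X t \<omega>) + (\<Sum>t\<in>G. b t * X t \<omega>)" for \<omega>
  proof -
    have "(\<Sum>t\<in>F \<union> G. d t * X t \<omega>) = (\<Sum>t\<in>F \<union> G. (if t \<in> F then a t * X t \<omega> else 0))
        + (\<Sum>t\<in>F \<union> G. (if t \<in> G then b t * X t \<omega> else 0))"
      unfolding sum.distrib[symmetric] by (intro sum.cong) (auto simp: d_def algebra_simps)
    also have "\<dots> = (\<Sum>t\<in>F. a t * X t \<omega>) + (\<Sum>t\<in>G. b t * X t \<omega>)"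
      using F(1) G(1) by (intro arg_cong2[where f = "(+)"] sum.mono_neutral_cong_right) auto
    finally show ?thesis .
  qed
  then have "(\<lambda>\<omega>. f \<omega> + g \<omega>) = (\<lambda>\<omega>. Re (\<Sum>t\<in>F \<union> G. d t * X t \<omega>))"
    by (simp add: F(3) G(3))
  then show "(\<lambda>\<omega>. f \<omega> + g \<omega>) \<in> real_span X"
    using F(1,2) G(1,2) by (simp only: real_spanI finite_UnI Un_subset_iff)
qed

section \<open>Second moments of the ambiguity integrand\<close>

text \<open>Two of the four factors are conjugated. The first two pairings match a plain factor with
  a conjugated one and yield covariances \<open>R\<close>; the third matches like with like and
  yields pseudo-covariances \<open>P\<close>.\<close>

lemma ambiguity_integrand_covariance:
  fixes \<theta> :: real
  assumes "prob_space M" "gaussian_process M X" "zero_mean M X"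
    and pos: "0 < \<tau>" "0 < t" "0 < s"
  defines "R \<equiv> \<lambda>t s. \<integral>\<omega>. X t \<omega> * cnj (X s \<omega>) \<partial>M" and "P \<equiv> \<lambda>t s. \<integral>\<omega>. X t \<omega> * X s \<omega> \<partial>M"
    and "p \<equiv> \<lambda>t. complex_of_real t powr (- (\<i> * complex_of_real (2 * pi * \<theta>)) - 1)"
  shows "(\<integral>\<omega>. ambiguity_integrand X \<theta> \<tau> t \<omega> * cnj (ambiguity_integrand X \<theta> \<tau> s \<omega>) \<partial>M) =
    (R (t * sqrt \<tau>) (t / sqrt \<tau>) * cnj (R (s * sqrt \<tau>) (s / sqrt \<tau>)) +
     R (t * sqrt \<tau>) (s * sqrt \<tau>) * cnj (R (t / sqrt \<tau>) (s / sqrt \<tau>)) +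
     P (t * sqrt \<tau>) (s / sqrt \<tau>) * cnj (P (t / sqrt \<tau>) (s * sqrt \<tau>))) * (p t * cnj (p s))"
proof -
  interpret isserlis_space M "real_span X"
    using assms(1-3) by (rule isserlis_space_gaussian_process)
  \<comment> \<open>The coefficients \<open>1\<close>, \<open>-\<i>\<close> and \<open>\<i>\<close>
    produce the real part, the imaginary part and its negative, the last one for the
    conjugate.\<close>
  have X: "X r \<in> complexified" "(\<lambda>\<omega>. cnj (X r \<omega>)) \<in> complexified" if "0 < r" for r
    using real_span_singleton[OF that, of 1 X] real_span_singleton[OF that, of "-\<i>" X]
      real_span_singleton[OF that, of "\<i>" X]
    by (simp_all add: complexified_def)
  have c: "(\<integral>\<omega>. cnj (X t \<omega>) * X s \<omega> \<partial>M) = cnj (R t s)"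
    "(\<integral>\<omega>. cnj (X t \<omega>) * cnj (X s \<omega>) \<partial>M) = cnj (P t s)" for t s
    using Bochner_Integration.integral_cnj[of M "\<lambda>\<omega>. X t \<omega> * cnj (X s \<omega>)"] Bochner_Integration.integral_cnj[of M "\<lambda>\<omega>. X t \<omega> * X s \<omega>"]
    by (simp_all add: R_def P_def)
  have "(\<integral>\<omega>. ambiguity_integrand X \<theta> \<tau> t \<omega> * cnj (ambiguity_integrand X \<theta> \<tau> s \<omega>) \<partial>M) =
      (\<integral>\<omega>. X (t * sqrt \<tau>) \<omega> * cnj (X (t / sqrt \<tau>) \<omega>) * cnj (X (s * sqrt \<tau>) \<omega>) * X (s / sqrt \<tau>) \<omega>
        * (p t * cnj (p s)) \<partial>M)"
    unfolding ambiguity_integrand_def p_def by (simp add: mult_ac)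
  also have "\<dots> = (\<integral>\<omega>. X (t * sqrt \<tau>) \<omega> * cnj (X (t / sqrt \<tau>) \<omega>) * cnj (X (s * sqrt \<tau>) \<omega>)
      * X (s / sqrt \<tau>) \<omega> \<partial>M) * (p t * cnj (p s))"
    by (rule integral_mult_left_zero)
  also have "(\<integral>\<omega>. X (t * sqrt \<tau>) \<omega> * cnj (X (t / sqrt \<tau>) \<omega>) * cnj (X (s * sqrt \<tau>) \<omega>)
      * X (s / sqrt \<tau>) \<omega> \<partial>M) =
     R (t * sqrt \<tau>) (t / sqrt \<tau>) * cnj (R (s * sqrt \<tau>) (s / sqrt \<tau>)) +
     R (t * sqrt \<tau>) (s * sqrt \<tau>) * cnj (R (t / sqrt \<tau>) (s / sqrt \<tau>)) +
     P (t * sqrt \<tau>) (s / sqrt \<tau>) * cnj (P (t / sqrt \<tau>) (s * sqrt \<tau>))"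
    using pos by (subst isserlis) (simp_all add: X c R_def P_def)
  finally show ?thesis .
qed

text \<open>A quarter turn leaves the law unchanged but multiplies \<open>X t * X s\<close> by
  \<open>\<i>^2 = -1\<close>, so the expectation equals its own negative.\<close>

lemma circularly_symmetric_pseudocovariance:
  assumes "circularly_symmetric M X" and meas: "\<And>t. 0 < t \<Longrightarrow> X t \<in> borel_measurable M"
    and t: "0 < t" and s: "0 < s"
  shows "(\<integral>\<omega>. X t \<omega> * X s \<omega> \<partial>M) = 0"
proof -
  \<comment> \<open>The product depends on two coordinates of the path, so its expectation is
    determined by the law of the process.\<close>
  have law: "(\<integral>\<omega>. (a * X t \<omega>) * (a * X s \<omega>) \<partial>M) =
      (\<integral>f. f t * f s \<partial>process_law M (\<lambda>t \<omega>. a * X t \<omega>))" for a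
  proof -
    have "(\<lambda>\<omega>. \<lambda>t\<in>{0<..}. a * X t \<omega>) \<in> M \<rightarrow>\<^sub>M Pi\<^sub>M {0<..} (\<lambda>_. borel)"
      using meas by (intro measurable_restrict) auto
    moreover have "(\<lambda>f. f t * f s) \<in> borel_measurable (Pi\<^sub>M {0<..} (\<lambda>_. borel :: complex measure))"
      using t s by (intro borel_measurable_times measurable_component_singleton) auto
    ultimately show ?thesis
      using t s unfolding process_law_def by (subst integral_distr) auto
  qed
  have "process_law M (\<lambda>t \<omega>. cis 0 * X t \<omega>) = process_law M (\<lambda>t \<omega>. cis (pi / 2) * X t \<omega>)"
    using assms(1) pi_gt_zero unfolding circularly_symmetric_def by (auto simp del: cis_zero cis_pi_half)
  then have "(\<integral>\<omega>. (cis 0 * X t \<omega>) * (cis 0 * X s \<omega>) \<partial>M) =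
      (\<integral>\<omega>. (cis (pi / 2) * X t \<omega>) * (cis (pi / 2) * X s \<omega>) \<partial>M)"
    unfolding law by simp
  also have "\<dots> = (\<integral>\<omega>. - (X t \<omega> * X s \<omega>) \<partial>M)"
    by (simp add: algebra_simps)
  finally show ?thesis by simp
qed

text \<open>The phases combine to that of \<open>t / s\<close> and the moduli to
  \<open>1 / (t * s)\<close>. Splitting the modulus in this way leaves the power that belongs to a
  Mellin integral in \<open>t / s\<close>, the factor \<open>1 / u\<close> of the Haar measure in
  \<open>u = sqrt (t * s)\<close>, and the weight that cancels the Jacobian.\<close>

lemma powr_quadrant_change:
  assumes "0 < t" "0 < s"
  shows "complex_of_real t powr (- (\<i> * complex_of_real x) - 1) *
      cnj (complex_of_real s powr (- (\<i> * complex_of_real x) - 1)) =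
    complex_of_real (t / s) powr (- (\<i> * complex_of_real x) - 1) / complex_of_real (sqrt (t * s)) *
      complex_of_real (t / (s * sqrt (t * s)))"
proof -
  \<comment> \<open>On positive reals the principal logarithm is real, so in exponential coordinates
    the complex powers reduce to sums of exponents.\<close>
  obtain a b where ab: "t = exp a" "s = exp b"
    using assms by (metis exp_ln)
  have "sqrt (exp a * exp b) = exp ((a + b) / 2)"
    by (rule real_sqrt_unique) (simp_all add: power2_eq_square flip: exp_add)
  then show ?thesis
    unfolding ab by (simp add: powr_def exp_of_real[symmetric] Ln_of_real exp_cnj flip: exp_add exp_diff exp_minus)
      (simp add: field_simps exp_add exp_diff exp_minus)
qed

subsection \<open>The optimal kernel\<close>

text \<open>The terms are arranged for integration: the first as a function of \<open>t\<close>
  times a function of \<open>s\<close>, the other two with the weight \<open>\<kappa>\<close> in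
  front, as the change of coordinates requires.\<close>

lemma ambiguity_second_moment:
  fixes Q C :: "real \<Rightarrow> complex" and \<theta> :: real
  assumes "prob_space M" "gaussian_process M X" "zero_mean M X" "lssp M X H q C"
    and Q: "Q = lssp_Q H q"
    and pos: "0 < \<tau>" "0 < t" "0 < s"
  defines "p \<equiv> \<lambda>t. complex_of_real t powr (- (\<i> * complex_of_real (2 * pi * \<theta>)) - 1)"
    and "P \<equiv> \<lambda>t s. \<integral>\<omega>. X t \<omega> * X s \<omega> \<partial>M"
    and "\<kappa> \<equiv> complex_of_real (t / (s * sqrt (t * s)))" and "u \<equiv> sqrt (t * s)"
  shows "(\<integral>\<omega>. ambiguity_integrand X \<theta> \<tau> t \<omega> * cnj (ambiguity_integrand X \<theta> \<tau> s \<omega>) \<partial>M) =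
    (C \<tau> * (Q t * p t)) * cnj (C \<tau> * (Q s * p s)) +
    (Q (u * sqrt \<tau>) * cnj (Q (u / sqrt \<tau>)) / complex_of_real u) *
      (complex_of_real ((cmod (C (t / s)))\<^sup>2) * p (t / s)) * \<kappa> +
    P (t * sqrt \<tau>) (s / sqrt \<tau>) * cnj (P (t / sqrt \<tau>) (s * sqrt \<tau>)) / complex_of_real u *
      p (t / s) * \<kappa>"
proof -
  have R: "(\<integral>\<omega>. X a \<omega> * cnj (X b \<omega>) \<partial>M) = Q (sqrt (a * b)) * C (a / b)" if "0 < a" "0 < b" for a b
    using assms(4) that by (auto simp: lssp_def Q)
  have pp: "p t * cnj (p s) = p (t / s) / complex_of_real u * \<kappa>"
    unfolding p_def u_def \<kappa>_def using pos(2,3) by (rule powr_quadrant_change)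
  \<comment> \<open>Within one integrand the two times have ratio \<open>\<tau>\<close> whatever
    \<open>r\<close> is, so \<open>C \<tau>\<close> comes out of the integral as a constant.\<close>
  have e: "sqrt (r * sqrt \<tau> * (r / sqrt \<tau>)) = r" "r * sqrt \<tau> / (r / sqrt \<tau>) = \<tau>" if "0 < r" for r
    using that pos(1) by (simp_all add: real_sqrt_mult real_sqrt_divide)
  have e': "sqrt (t * sqrt \<tau> * (s * sqrt \<tau>)) = u * sqrt \<tau>" "t * sqrt \<tau> / (s * sqrt \<tau>) = t / s"
    "sqrt (t / sqrt \<tau> * (s / sqrt \<tau>)) = u / sqrt \<tau>" "t / sqrt \<tau> / (s / sqrt \<tau>) = t / s"
    using pos by (simp_all add: u_def real_sqrt_mult real_sqrt_divide)
  have "(\<integral>\<omega>. ambiguity_integrand X \<theta> \<tau> t \<omega> * cnj (ambiguity_integrand X \<theta> \<tau> s \<omega>) \<partial>M) =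
      (Q t * C \<tau> * cnj (Q s * C \<tau>) +
       Q (u * sqrt \<tau>) * C (t / s) * cnj (Q (u / sqrt \<tau>) * C (t / s)) +
       P (t * sqrt \<tau>) (s / sqrt \<tau>) * cnj (P (t / sqrt \<tau>) (s * sqrt \<tau>))) * (p t * cnj (p s))"
    using pos unfolding ambiguity_integrand_covariance[OF assms(1-3) pos] p_def P_def
    by (simp only: R e e' mult_pos_pos divide_pos_pos real_sqrt_gt_zero)
  also have "\<dots> = Q t * C \<tau> * cnj (Q s * C \<tau>) * (p t * cnj (p s)) +
     (Q (u * sqrt \<tau>) * cnj (Q (u / sqrt \<tau>)) * (C (t / s) * cnj (C (t / s))) +
      P (t * sqrt \<tau>) (s / sqrt \<tau>) * cnj (P (t / sqrt \<tau>) (s * sqrt \<tau>))) *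
     (p (t / s) / complex_of_real u * \<kappa>)"
    unfolding pp[symmetric] by (simp add: algebra_simps)
  also have "C (t / s) * cnj (C (t / s)) = complex_of_real ((cmod (C (t / s)))\<^sup>2)"
    by (simp only: complex_norm_square)
  finally show ?thesis
    by (simp add: algebra_simps)
qed

text \<open>Covers both cases of the theorem: the pseudo-covariance term is only required to
  separate into \<open>f\<close> of the geometric mean and \<open>g\<close> of the ratio.\<close>

lemma phi_opt_formula:
  fixes Q C :: "real \<Rightarrow> complex" and f g :: "real \<Rightarrow> complex"
  assumes "prob_space M" "gaussian_process M X" "zero_mean M X" "lssp M X H q C"
    and Q: "Q = lssp_Q H q"
    and inter: "ambiguity_interchange M X A" and conv: "kernel_abs_conv Q C"
    and supp: "(\<theta>, \<tau>) \<in> ambiguity_support M A"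
    and f: "set_integrable lborel {0<..} f" and g: "set_integrable lborel {0<..} g"
    and fg: "\<And>t s. 0 < t \<Longrightarrow> 0 < s \<Longrightarrow>
      (\<integral>\<omega>. X (t * sqrt \<tau>) \<omega> * X (s / sqrt \<tau>) \<omega> \<partial>M) *
        cnj (\<integral>\<omega>. X (t / sqrt \<tau>) \<omega> * X (s * sqrt \<tau>) \<omega> \<partial>M) / complex_of_real (sqrt (t * s)) *
        complex_of_real (t / s) powr (- (\<i> * complex_of_real (2 * pi * \<theta>)) - 1) =
      f (sqrt (t * s)) * g (t / s)"
  defines "m \<equiv> mellin Q (\<i> * complex_of_real (2 * pi * \<theta>))"
  shows "complex_of_real (phi_opt M A \<theta> \<tau>) =
    (complex_of_real ((cmod (C \<tau>))\<^sup>2) * complex_of_real ((cmod m)\<^sup>2)) /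
    (complex_of_real ((cmod (C \<tau>))\<^sup>2) * complex_of_real ((cmod m)\<^sup>2)
     + mellin (\<lambda>v. complex_of_real ((cmod (C v))\<^sup>2)) (\<i> * complex_of_real (2 * pi * \<theta>)) *
         scale_conv Q (\<lambda>u. cnj (Q u)) \<tau>
     + (LINT v:{0<..}|lborel. g v) * (LINT u:{0<..}|lborel. f u))"
proof -
  define p where "p t = complex_of_real t powr (- (\<i> * complex_of_real (2 * pi * \<theta>)) - 1)" for t
  have \<tau>: "0 < \<tau>" and power: "0 < ambiguity_power M A \<theta> \<tau>"
    using supp by (auto simp: ambiguity_support_def)
  have Qp: "set_integrable lborel {0<..} (\<lambda>t. Q t * p t)"
    and Cp: "set_integrable lborel {0<..} (\<lambda>v. complex_of_real ((cmod (C v))\<^sup>2) * p v)"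
    and QQ: "set_integrable lborel {0<..} (\<lambda>u. Q (u * sqrt \<tau>) * cnj (Q (u / sqrt \<tau>)) / complex_of_real u)"
    using conv \<tau> unfolding kernel_abs_conv_def mellin_abs_conv_def scale_conv_abs_conv_def p_def by blast+
  have m: "(LINT t:{0<..}|lborel. Q t * p t) = m"
    unfolding m_def mellin_def p_def ..

  have "expected_ambiguity M A \<theta> \<tau> =
      (LINT t:{0<..}|lborel. (\<integral>\<omega>. ambiguity_integrand X \<theta> \<tau> t \<omega> \<partial>M))"
    using inter \<tau> by (auto simp: ambiguity_interchange_def)
  also have "\<dots> = (LINT t:{0<..}|lborel. C \<tau> * (Q t * p t))"
  proof (rule set_lebesgue_integral_cong)
    show "\<forall>t. t \<in> {0<..} \<longrightarrow> (\<integral>\<omega>. ambiguity_integrand X \<theta> \<tau> t \<omega> \<partial>M) = C \<tau> * (Q t * p t)"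
    proof (intro allI impI)
      fix t :: real assume "t \<in> {0<..}"
      then have "sqrt (t * sqrt \<tau> * (t / sqrt \<tau>)) = t" "t * sqrt \<tau> / (t / sqrt \<tau>) = \<tau>"
        "0 < t * sqrt \<tau>" "0 < t / sqrt \<tau>"
        using \<tau> by (simp_all add: real_sqrt_mult real_sqrt_divide)
      then have "(\<integral>\<omega>. X (t * sqrt \<tau>) \<omega> * cnj (X (t / sqrt \<tau>) \<omega>) \<partial>M) = Q t * C \<tau>"
        using assms(4) unfolding lssp_def Q by metis
      then show "(\<integral>\<omega>. ambiguity_integrand X \<theta> \<tau> t \<omega> \<partial>M) = C \<tau> * (Q t * p t)"
        unfolding ambiguity_integrand_def p_def[symmetric] by simp
    qed
  qed simp
  also have "\<dots> = C \<tau> * m"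
    by (simp add: m)
  finally have mean: "expected_ambiguity M A \<theta> \<tau> = C \<tau> * m" .

  let ?K1 = "\<lambda>(t, s). (C \<tau> * (Q t * p t)) * cnj (C \<tau> * (Q s * p s))"
  let ?K2 = "\<lambda>(t, s). (Q (sqrt (t * s) * sqrt \<tau>) * cnj (Q (sqrt (t * s) / sqrt \<tau>)) /
      complex_of_real (sqrt (t * s))) * (complex_of_real ((cmod (C (t / s)))\<^sup>2) * p (t / s)) *
      complex_of_real (t / (s * sqrt (t * s)))"
  let ?K3 = "\<lambda>(t, s). f (sqrt (t * s)) * g (t / s) * complex_of_real (t / (s * sqrt (t * s)))"
  have cnjI: "set_integrable lborel {0<..} (\<lambda>t. cnj (C \<tau> * (Q t * p t)))"
    "(LINT t:{0<..}|lborel. cnj (C \<tau> * (Q t * p t))) = cnj (C \<tau> * m)"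
  proof -
    have *: "indicator {0<..} t *\<^sub>R cnj (C \<tau> * (Q t * p t)) = cnj (indicator {0<..} t *\<^sub>R (C \<tau> * (Q t * p t)))"
      for t by simp
    have i: "set_integrable lborel {0<..} (\<lambda>t. C \<tau> * (Q t * p t))"
      using Qp by simp
    show "set_integrable lborel {0<..} (\<lambda>t. cnj (C \<tau> * (Q t * p t)))"
      using i unfolding set_integrable_def * by (rule integrable_cnj)
    have "(LINT t:{0<..}|lborel. cnj (C \<tau> * (Q t * p t))) = cnj (LINT t:{0<..}|lborel. C \<tau> * (Q t * p t))"
      unfolding set_lebesgue_integral_def * by (rule Bochner_Integration.integral_cnj)
    then show "(LINT t:{0<..}|lborel. cnj (C \<tau> * (Q t * p t))) = cnj (C \<tau> * m)"
      by (simp add: m)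
  qed
  have "has_bochner_integral lborel (\<lambda>x. indicator ({0<..} \<times> {0<..}) x *\<^sub>R ?K1 x)
      ((LINT t:{0<..}|lborel. C \<tau> * (Q t * p t)) * (LINT t:{0<..}|lborel. cnj (C \<tau> * (Q t * p t))))"
    using Qp cnjI(1) by (intro has_bochner_integral_mult_quadrant) auto
  moreover have "has_bochner_integral lborel (\<lambda>x. indicator ({0<..} \<times> {0<..}) x *\<^sub>R ?K2 x)
      (scale_conv Q (\<lambda>u. cnj (Q u)) \<tau> *
       mellin (\<lambda>v. complex_of_real ((cmod (C v))\<^sup>2)) (\<i> * complex_of_real (2 * pi * \<theta>)))"
    unfolding scale_conv_def mellin_def p_def[symmetric]
    by (intro has_bochner_integral_sqrt_quotient QQ Cp) simp
  moreover have "has_bochner_integral lborel (\<lambda>x. indicator ({0<..} \<times> {0<..}) x *\<^sub>R ?K3 x)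
      ((LINT u:{0<..}|lborel. f u) * (LINT v:{0<..}|lborel. g v))"
    by (intro has_bochner_integral_sqrt_quotient f g) simp
  \<comment> \<open>Each term comes with its own integrability, so the integral of the sum splits
    into the three products.\<close>
  ultimately have "has_bochner_integral lborel
      (\<lambda>x. indicator ({0<..} \<times> {0<..}) x *\<^sub>R ?K1 x + indicator ({0<..} \<times> {0<..}) x *\<^sub>R ?K2 x
        + indicator ({0<..} \<times> {0<..}) x *\<^sub>R ?K3 x)
      ((LINT t:{0<..}|lborel. C \<tau> * (Q t * p t)) * (LINT t:{0<..}|lborel. cnj (C \<tau> * (Q t * p t))) +
       scale_conv Q (\<lambda>u. cnj (Q u)) \<tau> *
       mellin (\<lambda>v. complex_of_real ((cmod (C v))\<^sup>2)) (\<i> * complex_of_real (2 * pi * \<theta>)) +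
       (LINT u:{0<..}|lborel. f u) * (LINT v:{0<..}|lborel. g v))" (is "has_bochner_integral _ _ ?D")
    by (intro has_bochner_integral_add)
  then have "(\<integral>x. indicator ({0<..} \<times> {0<..}) x *\<^sub>R ?K1 x + indicator ({0<..} \<times> {0<..}) x *\<^sub>R ?K2 x
        + indicator ({0<..} \<times> {0<..}) x *\<^sub>R ?K3 x \<partial>lborel) = ?D"
    by (rule has_bochner_integral_integral_eq)
  also have "(\<integral>x. indicator ({0<..} \<times> {0<..}) x *\<^sub>R ?K1 x + indicator ({0<..} \<times> {0<..}) x *\<^sub>R ?K2 x
        + indicator ({0<..} \<times> {0<..}) x *\<^sub>R ?K3 x \<partial>lborel) = complex_of_real (ambiguity_power M A \<theta> \<tau>)"
  proof -
    have "complex_of_real (ambiguity_power M A \<theta> \<tau>) =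
       (LINT x:{0<..} \<times> {0<..}|lborel. (case x of (t, s) \<Rightarrow>
         \<integral>\<omega>. ambiguity_integrand X \<theta> \<tau> t \<omega> * cnj (ambiguity_integrand X \<theta> \<tau> s \<omega>) \<partial>M))"
      using inter \<tau> unfolding ambiguity_interchange_def by blast
    also have "\<dots> = (\<integral>x. indicator ({0<..} \<times> {0<..}) x *\<^sub>R ?K1 x + indicator ({0<..} \<times> {0<..}) x *\<^sub>R ?K2 x
        + indicator ({0<..} \<times> {0<..}) x *\<^sub>R ?K3 x \<partial>lborel)"
      unfolding set_lebesgue_integral_def
    proof (rule Bochner_Integration.integral_cong[OF refl])
      fix x :: "real \<times> real"
      obtain t s where x: "x = (t, s)" by (cases x)
      show "indicator ({0<..} \<times> {0<..}) x *\<^sub>R (case x of (t, s) \<Rightarrow>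
          \<integral>\<omega>. ambiguity_integrand X \<theta> \<tau> t \<omega> * cnj (ambiguity_integrand X \<theta> \<tau> s \<omega>) \<partial>M) =
        indicator ({0<..} \<times> {0<..}) x *\<^sub>R ?K1 x + indicator ({0<..} \<times> {0<..}) x *\<^sub>R ?K2 x
        + indicator ({0<..} \<times> {0<..}) x *\<^sub>R ?K3 x"
      proof (cases "0 < t \<and> 0 < s")
        case True
        then show ?thesis
          unfolding p_def x
          using ambiguity_second_moment[OF assms(1-4) Q \<tau>, of t s \<theta>] fg[of t s]
          by (simp only: prod.case scaleR_add_right)
      qed (auto simp: x)
    qed
    finally show ?thesis ..
  qed
  finally have second: "complex_of_real (ambiguity_power M A \<theta> \<tau>) = ?D" .
  have "complex_of_real (phi_opt M A \<theta> \<tau>) =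
      complex_of_real ((cmod (C \<tau>))\<^sup>2) * complex_of_real ((cmod m)\<^sup>2) / complex_of_real (ambiguity_power M A \<theta> \<tau>)"
    \<comment> \<open>On the support the indicator in \<open>phi_opt\<close> is 1.\<close>
    using supp by (simp add: phi_opt_def mean norm_mult power_mult_distrib)
  also have "complex_of_real (ambiguity_power M A \<theta> \<tau>) =
     complex_of_real ((cmod (C \<tau>))\<^sup>2) * complex_of_real ((cmod m)\<^sup>2)
     + mellin (\<lambda>v. complex_of_real ((cmod (C v))\<^sup>2)) (\<i> * complex_of_real (2 * pi * \<theta>)) *
         scale_conv Q (\<lambda>u. cnj (Q u)) \<tau>
     + (LINT v:{0<..}|lborel. g v) * (LINT u:{0<..}|lborel. f u)"
    unfolding second cnjI(2) complex_norm_square by (simp add: m mult_ac)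
  finally show ?thesis .
qed

section \<open>The circularly symmetric and the real-valued case\<close>

theorem proposition7:
  fixes M :: "'a measure"
    and X :: "real \<Rightarrow> 'a \<Rightarrow> complex"
    and A :: "real \<Rightarrow> real \<Rightarrow> 'a \<Rightarrow> complex"
    and H :: real
    and q Q C :: "real \<Rightarrow> complex"
  assumes "prob_space M"
    and "gaussian_process M X"
    and "zero_mean M X"
    and "lssp M X H q C"
    and "Q = lssp_Q H q"
    and "is_ambiguity_function M X A"
    and "ambiguity_interchange M X A"
    and "kernel_abs_conv Q C"
  shows "(circularly_symmetric M X \<longrightarrow>
           (\<forall>(\<theta>, \<tau>)\<in>ambiguity_support M A.
              complex_of_real (phi_opt M A \<theta> \<tau>) =
                (complex_of_real ((cmod (C \<tau>))\<^sup>2) *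
                 complex_of_real ((cmod (mellin Q (\<i> * complex_of_real (2 * pi * \<theta>))))\<^sup>2)) /
                (complex_of_real ((cmod (C \<tau>))\<^sup>2) *
                 complex_of_real ((cmod (mellin Q (\<i> * complex_of_real (2 * pi * \<theta>))))\<^sup>2)
                 + mellin (\<lambda>v. complex_of_real ((cmod (C v))\<^sup>2)) (\<i> * complex_of_real (2 * pi * \<theta>)) *
                   scale_conv Q (\<lambda>u. cnj (Q u)) \<tau>)))
       \<and> (real_valued_process M X \<and> kernel_D2_abs_conv Q C \<longrightarrow>
           (\<forall>(\<theta>, \<tau>)\<in>ambiguity_support M A.
              complex_of_real (phi_opt M A \<theta> \<tau>) =
                (complex_of_real ((cmod (C \<tau>))\<^sup>2) *
                 complex_of_real ((cmod (mellin Q (\<i> * complex_of_real (2 * pi * \<theta>))))\<^sup>2)) /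
                (complex_of_real ((cmod (C \<tau>))\<^sup>2) *
                 complex_of_real ((cmod (mellin Q (\<i> * complex_of_real (2 * pi * \<theta>))))\<^sup>2)
                 + mellin (\<lambda>v. complex_of_real ((cmod (C v))\<^sup>2)) (\<i> * complex_of_real (2 * pi * \<theta>)) *
                   scale_conv Q (\<lambda>u. cnj (Q u)) \<tau>
                 + kernel_D2 Q C \<theta> \<tau>)))"
proof (intro conjI impI ballI; clarify)
  fix \<theta> \<tau>
  assume circ: "circularly_symmetric M X" and supp: "(\<theta>, \<tau>) \<in> ambiguity_support M A"
  have "0 < \<tau>"
    using supp by (simp add: ambiguity_support_def)
  have "X t \<in> borel_measurable M" if "0 < t" for t
    using assms(3) that by (auto simp: zero_mean_def)
  then have "(\<integral>\<omega>. X t \<omega> * X s \<omega> \<partial>M) = 0" if "0 < t" "0 < s" for t s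
    using circularly_symmetric_pseudocovariance[OF circ] that by blast
  then show "complex_of_real (phi_opt M A \<theta> \<tau>) =
      (complex_of_real ((cmod (C \<tau>))\<^sup>2) *
       complex_of_real ((cmod (mellin Q (\<i> * complex_of_real (2 * pi * \<theta>))))\<^sup>2)) /
      (complex_of_real ((cmod (C \<tau>))\<^sup>2) *
       complex_of_real ((cmod (mellin Q (\<i> * complex_of_real (2 * pi * \<theta>))))\<^sup>2)
       + mellin (\<lambda>v. complex_of_real ((cmod (C v))\<^sup>2)) (\<i> * complex_of_real (2 * pi * \<theta>)) *
         scale_conv Q (\<lambda>u. cnj (Q u)) \<tau>)"
    \<comment> \<open>The pseudo-covariances vanish, so both separated functions are zero.\<close>
    using phi_opt_formula[OF assms(1-5,7,8) supp, of "\<lambda>_. 0" "\<lambda>_. 0"] \<open>0 < \<tau>\<close>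
    by (simp add: set_integrable_def set_lebesgue_integral_def)
next
  fix \<theta> \<tau>
  assume real: "real_valued_process M X" and conv: "kernel_D2_abs_conv Q C"
    and supp: "(\<theta>, \<tau>) \<in> ambiguity_support M A"
  have \<tau>: "0 < \<tau>"
    using supp by (simp add: ambiguity_support_def)
  have cnj_X: "cnj (X t \<omega>) = X t \<omega>" if "0 < t" "\<omega> \<in> space M" for t \<omega>
    using real that by (simp add: real_valued_process_def Reals_cnj_iff)
  \<comment> \<open>For a real process the pseudo-covariance is the covariance and is real; hence
    the term contains \<open>Q\<close> squared and an unconjugated product of values of
    \<open>C\<close>.\<close>
  have P: "(\<integral>\<omega>. X t \<omega> * X s \<omega> \<partial>M) = Q (sqrt (t * s)) * C (t / s)"
    and cnj_P: "cnj (\<integral>\<omega>. X t \<omega> * X s \<omega> \<partial>M) = Q (sqrt (t * s)) * C (t / s)" if "0 < t" "0 < s" for t s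
  proof -
    have "(\<integral>\<omega>. X t \<omega> * X s \<omega> \<partial>M) = (\<integral>\<omega>. X t \<omega> * cnj (X s \<omega>) \<partial>M)"
      using that by (intro Bochner_Integration.integral_cong) (auto simp: cnj_X)
    also have "\<dots> = Q (sqrt (t * s)) * C (t / s)"
      using assms(4,5) that by (auto simp: lssp_def)
    finally show "(\<integral>\<omega>. X t \<omega> * X s \<omega> \<partial>M) = Q (sqrt (t * s)) * C (t / s)" .
    moreover have "cnj (\<integral>\<omega>. X t \<omega> * X s \<omega> \<partial>M) = (\<integral>\<omega>. cnj (X t \<omega> * X s \<omega>) \<partial>M)"
      by (rule Bochner_Integration.integral_cnj[symmetric])
    moreover have "\<dots> = (\<integral>\<omega>. X t \<omega> * X s \<omega> \<partial>M)"
      using that by (intro Bochner_Integration.integral_cong) (auto simp: cnj_X)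
    ultimately show "cnj (\<integral>\<omega>. X t \<omega> * X s \<omega> \<partial>M) = Q (sqrt (t * s)) * C (t / s)"
      by simp
  qed
  show "complex_of_real (phi_opt M A \<theta> \<tau>) =
      (complex_of_real ((cmod (C \<tau>))\<^sup>2) *
       complex_of_real ((cmod (mellin Q (\<i> * complex_of_real (2 * pi * \<theta>))))\<^sup>2)) /
      (complex_of_real ((cmod (C \<tau>))\<^sup>2) *
       complex_of_real ((cmod (mellin Q (\<i> * complex_of_real (2 * pi * \<theta>))))\<^sup>2)
       + mellin (\<lambda>v. complex_of_real ((cmod (C v))\<^sup>2)) (\<i> * complex_of_real (2 * pi * \<theta>)) *
         scale_conv Q (\<lambda>u. cnj (Q u)) \<tau>
       + kernel_D2 Q C \<theta> \<tau>)"
    unfolding kernel_D2_def C_ambiguity_sq_def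
  \<comment> \<open>Matching the two integrals in \<open>kernel_D2\<close> chooses \<open>g\<close>
    as the integrand in \<open>v\<close> and \<open>f u\<close> as the square of \<open>Q u\<close>
    over \<open>u\<close>.\<close>
  proof (rule phi_opt_formula[OF assms(1-5,7,8) supp])
    show "set_integrable lborel {0<..} (\<lambda>u. (Q u)\<^sup>2 / complex_of_real u)"
      "set_integrable lborel {0<..} (C_ambiguity_sq_integrand C \<theta> \<tau>)"
      using conv \<tau> by (auto simp: kernel_D2_abs_conv_def)
    fix t s :: real
    assume ts: "0 < t" "0 < s"
    \<comment> \<open>Opposite shifts cancel in the geometric mean and multiply up in the ratio,
      which is where \<open>v * \<tau>\<close> and \<open>v / \<tau>\<close> come from.\<close>
    have "t * sqrt \<tau> * (s / sqrt \<tau>) = t * s" "t / sqrt \<tau> * (s * sqrt \<tau>) = t * s"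
      "t * sqrt \<tau> / (s / sqrt \<tau>) = t / s * \<tau>" "t / sqrt \<tau> / (s * sqrt \<tau>) = t / s / \<tau>"
      using ts \<tau> by (simp_all add: field_simps)
    then have "(\<integral>\<omega>. X (t * sqrt \<tau>) \<omega> * X (s / sqrt \<tau>) \<omega> \<partial>M) = Q (sqrt (t * s)) * C (t / s * \<tau>)"
      "cnj (\<integral>\<omega>. X (t / sqrt \<tau>) \<omega> * X (s * sqrt \<tau>) \<omega> \<partial>M) = Q (sqrt (t * s)) * C (t / s / \<tau>)"
      using ts \<tau> P[of "t * sqrt \<tau>" "s / sqrt \<tau>"] cnj_P[of "t / sqrt \<tau>" "s * sqrt \<tau>"]
      by (simp_all only: mult_pos_pos divide_pos_pos real_sqrt_gt_zero)
    then show "(\<integral>\<omega>. X (t * sqrt \<tau>) \<omega> * X (s / sqrt \<tau>) \<omega> \<partial>M) *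
        cnj (\<integral>\<omega>. X (t / sqrt \<tau>) \<omega> * X (s * sqrt \<tau>) \<omega> \<partial>M) / complex_of_real (sqrt (t * s)) *
        complex_of_real (t / s) powr (- (\<i> * complex_of_real (2 * pi * \<theta>)) - 1) =
      (Q (sqrt (t * s)))\<^sup>2 / complex_of_real (sqrt (t * s)) * C_ambiguity_sq_integrand C \<theta> \<tau> (t / s)"
      by (simp only: C_ambiguity_sq_integrand_def) (simp add: power2_eq_square)
  qed
qed

end
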